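(* Let $m,\tilde m\ge 1$ be integers and let $n$ be an even positive integer. Then there exists the Baker-Akhiezer function for the configuration $\mathcal{A}_{(m,\tilde m,1^n)}$.
   Context: A configuration is a finite set of pairwise non-collinear non-isotropic vectors $\alpha_i\in\mathbb{C}^2$ with multiplicities $m_i\in\mathbb{N}$; $(u,v)=u_1v_1+u_2v_2$. Baker-Akhiezer (BA) function of a configuration: a function $\phi(\lambda,x)$, $\lambda,x\in\mathbb{C}^2$, such that (1) $\phi(\lambda,x)=P(\lambda,x)e^{(\lambda,x)}$ where $P$ is a polynomial in $\lambda$ and $x$ with highest term $\prod_{i}(\alpha_i,\lambda)^{m_i}(\alpha_i,x)^{m_i}$; (2) for all $i$ and all $1\le s\le m_i$, $\partial_{\alpha_i}^{2s-1}\phi(\lambda,x)|_{\Pi_i}=0$, where $\Pi_i=\{x:(\alpha_i,x)=0\}$ and $\partial_{\alpha_i}=(\alpha_i,\frac{\partial}{\partial x})$. The configuration $\mathcal{A}_{(m,\tilde m,1^n)}$ ($n$ even) consists of pairwise non-collinear vectors $\alpha_0,\dots,\alpha_{n+1}\in\mathbb{R}^2$, which may be normalized as $\alpha_s=(\cos\varphi_s,\sin\varphi_s)$, with multiplicities $m_0=m$, $m_{n+1}=\tilde m$, $m_i=1$ for $1\le i\le n$, such that: $\alpha_0\perp\alpha_{n+1}$; the arrangement of lines (with multiplicities) is symmetric with respect to the reflection about $\alpha_0$; and, with $z_s=e^{2i\varphi_s}$, one has $\sum_{i=0,\,i\ne j}^{n+1}\frac{m_i(z_i+z_j)}{z_i-z_j}=0$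 for all $j=1,\dots,n$. Such a configuration exists and is unique up to equivalence (orthogonal transformations and rescaling of the vectors). *)

theory Defs
  imports "HOL-Analysis.Analysis"
begin

text \<open>
  The form below is complex bilinear; it is not the inner product of type
  \<^typ>\<open>complex ^ 2\<close>, which is real-valued and involves complex conjugation.
\<close>

definition bil :: "complex ^ 2 \<Rightarrow> complex ^ 2 \<Rightarrow> complex" where
  "bil u v = u $ 1 * v $ 1 + u $ 2 * v $ 2"

definition proportional :: "complex ^ 2 \<Rightarrow> complex ^ 2 \<Rightarrow> bool" where
  "proportional u v \<longleftrightarrow> (\<exists>c. u = c *s v \<or> v = c *s u)"

text \<open>Configurations are given as families of vectors indexed by a finite set.\<close>

definition configuration :: "'i set \<Rightarrow> ('i \<Rightarrow> complex ^ 2) \<Rightarrow> bool" where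
  "configuration I \<alpha> \<longleftrightarrow> finite I \<and> (\<forall>i\<in>I. bil (\<alpha> i) (\<alpha> i) \<noteq> 0) \<and>
     (\<forall>i\<in>I. \<forall>j\<in>I. i \<noteq> j \<longrightarrow> \<not> proportional (\<alpha> i) (\<alpha> j))"

text \<open>
  A quadruple \<open>(a, b, c, d)\<close> is the exponent of the monomial
  \<open>k\<^sub>1\<^sup>a k\<^sub>2\<^sup>b x\<^sub>1\<^sup>c x\<^sub>2\<^sup>d\<close>. The spectral variable is called \<open>k\<close>.
\<close>

type_synonym expo = "nat \<times> nat \<times> nat \<times> nat"

fun tdeg :: "expo \<Rightarrow> nat" where
  "tdeg (a, b, c, d) = a + b + c + d"

fun mono_eval :: "expo \<Rightarrow> complex ^ 2 \<Rightarrow> complex ^ 2 \<Rightarrow> complex" where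
  "mono_eval (a, b, c, d) k x = (k $ 1) ^ a * (k $ 2) ^ b * (x $ 1) ^ c * (x $ 2) ^ d"

definition homogeneous_poly ::
  "nat \<Rightarrow> (complex ^ 2 \<Rightarrow> complex ^ 2 \<Rightarrow> complex) \<Rightarrow> bool" where
  "homogeneous_poly d f \<longleftrightarrow>
     (\<exists>C :: expo \<Rightarrow> complex. \<forall>k x. f k x = (\<Sum>e | tdeg e = d. C e * mono_eval e k x))"

definition poly_deg_less ::
  "nat \<Rightarrow> (complex ^ 2 \<Rightarrow> complex ^ 2 \<Rightarrow> complex) \<Rightarrow> bool" where
  "poly_deg_less d f \<longleftrightarrow>
     (\<exists>C :: expo \<Rightarrow> complex. \<forall>k x. f k x = (\<Sum>e | tdeg e < d. C e * mono_eval e k x))"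

lemma finite_tdeg_less: "finite {e. tdeg e < d}"
proof (rule finite_subset)
  show "{e. tdeg e < d} \<subseteq> {..d} \<times> {..d} \<times> {..d} \<times> {..d}"
    by auto
qed simp

lemma finite_tdeg_eq: "finite {e. tdeg e = d}"
  by (rule finite_subset [OF _ finite_tdeg_less [of "Suc d"]]) auto

text \<open>
  \<open>T\<close> is the homogeneous component of highest total degree, in \<open>k\<close> and \<open>x\<close> jointly,
  of the polynomial \<open>P\<close>.
\<close>

definition highest_term ::
  "(complex ^ 2 \<Rightarrow> complex ^ 2 \<Rightarrow> complex) \<Rightarrow> (complex ^ 2 \<Rightarrow> complex ^ 2 \<Rightarrow> complex) \<Rightarrow> bool" where
  "highest_term P T \<longleftrightarrow>
     (\<exists>d. homogeneous_poly d T \<and> (\<exists>k x. T k x \<noteq> 0) \<and>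
          poly_deg_less d (\<lambda>k x. P k x - T k x))"

definition partial_deriv ::
  "2 \<Rightarrow> (complex ^ 2 \<Rightarrow> complex) \<Rightarrow> complex ^ 2 \<Rightarrow> complex" where
  "partial_deriv i f x = deriv (\<lambda>z. f (\<chi> j. if j = i then z else x $ j)) (x $ i)"

definition dir_deriv ::
  "complex ^ 2 \<Rightarrow> (complex ^ 2 \<Rightarrow> complex) \<Rightarrow> complex ^ 2 \<Rightarrow> complex" where
  "dir_deriv \<alpha> f x = \<alpha> $ 1 * partial_deriv 1 f x + \<alpha> $ 2 * partial_deriv 2 f x"

definition baker_akhiezer ::
  "'i set \<Rightarrow> ('i \<Rightarrow> complex ^ 2) \<Rightarrow> ('i \<Rightarrow> nat) \<Rightarrow>
   (complex ^ 2 \<Rightarrow> complex ^ 2 \<Rightarrow> complex) \<Rightarrow> bool" where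
  "baker_akhiezer I \<alpha> m \<phi> \<longleftrightarrow>
     (\<exists>P. highest_term P (\<lambda>k x. \<Prod>i\<in>I. bil (\<alpha> i) k ^ m i * bil (\<alpha> i) x ^ m i) \<and>
          (\<forall>k x. \<phi> k x = P k x * exp (bil k x))) \<and>
     (\<forall>i\<in>I. \<forall>s\<in>{1..m i}. \<forall>k x. bil (\<alpha> i) x = 0 \<longrightarrow>
          (dir_deriv (\<alpha> i) ^^ (2 * s - 1)) (\<phi> k) x = 0)"

definition complexify :: "real ^ 2 \<Rightarrow> complex ^ 2" where
  "complexify v = (\<chi> i. of_real (v $ i))"

definition mult_A :: "nat \<Rightarrow> nat \<Rightarrow> nat \<Rightarrow> nat \<Rightarrow> nat" where
  "mult_A m m' n i = (if i = 0 then m else if i = n + 1 then m' else 1)"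

definition orth_line :: "real ^ 2 \<Rightarrow> (real ^ 2) set" where
  "orth_line \<alpha> = {x. \<alpha> \<bullet> x = 0}"

definition reflection :: "real ^ 2 \<Rightarrow> real ^ 2 \<Rightarrow> real ^ 2" where
  "reflection \<alpha> x = x - (2 * (\<alpha> \<bullet> x) / (\<alpha> \<bullet> \<alpha>)) *\<^sub>R \<alpha>"

text \<open>
  The vectors need not have length one: \<open>\<theta> s\<close> is the angle of a unit vector spanning
  the same line as \<open>\<alpha> s\<close>. It is determined modulo \<open>\<pi>\<close>, so that \<open>cis (2 * \<theta> s)\<close>
  depends only on \<open>\<alpha> s\<close>.
\<close>

definition is_config_A :: "nat \<Rightarrow> nat \<Rightarrow> nat \<Rightarrow> (nat \<Rightarrow> real ^ 2) \<Rightarrow> bool" where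
  "is_config_A m m' n \<alpha> \<longleftrightarrow>
     configuration {0..n+1} (\<lambda>i. complexify (\<alpha> i)) \<and>
     \<alpha> 0 \<bullet> \<alpha> (n+1) = 0 \<and>
     (\<forall>i\<in>{0..n+1}. \<exists>j\<in>{0..n+1}. mult_A m m' n j = mult_A m m' n i \<and>
        reflection (\<alpha> 0) ` orth_line (\<alpha> i) = orth_line (\<alpha> j)) \<and>
     (\<exists>\<theta> :: nat \<Rightarrow> real.
        (\<forall>s\<in>{0..n+1}. \<exists>r. r \<noteq> 0 \<and> \<alpha> s = r *\<^sub>R vector [cos (\<theta> s), sin (\<theta> s)]) \<and>
        (\<forall>j\<in>{1..n}. (\<Sum>i\<in>{0..n+1} - {j}.
            of_nat (mult_A m m' n i) * (cis (2 * \<theta> i) + cis (2 * \<theta> j)) /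
              (cis (2 * \<theta> i) - cis (2 * \<theta> j))) = 0))"

end

theory Submission
  imports Defs
begin

text \<open>
  Put \<open>A(x) = \<Prod>\<^sub>i (\<alpha>\<^sub>i, x)\<^bsup>m i\<^esup>\<close> of degree \<open>M\<close>. The operator
  \<open>L = \<Delta> - 2 \<Sum>\<^sub>i m\<^sub>i (\<alpha>\<^sub>i, x)\<^sup>-\<^sup>1 \<partial>\<^bsub>\<alpha> i\<^esub>\<close> preserves the functions whose odd normal derivatives of
  order less than \<open>2 m\<^sub>i\<close> vanish on every line \<open>\<Pi>\<^sub>i\<close>, provided that for each \<open>a\<close> the sums
  \<open>\<Sum>\<^bsub>i \<noteq> a\<^esub> m\<^sub>i cot(\<phi>\<^sub>i - \<phi>\<^sub>a)\<^bsup>l\<^esup>\<close> vanish for odd \<open>l < 2 m\<^sub>a\<close>. For a line of multiplicity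
  one this is the given equation on the \<open>z\<^sub>i\<close>; for the two orthogonal lines of arbitrary
  multiplicity it follows from the reflection symmetry. The function \<open>A(x)\<^sup>2 e\<^bsup>(k,x)\<^esup>\<close> satisfies
  all the vanishing conditions, and hence so does \<open>(L - k\<^sup>2)\<^bsup>M\<^esup> [A(x)\<^sup>2 e\<^bsup>(k,x)\<^esup>]\<close>. On the terms of
  highest total degree \<open>L - k\<^sup>2\<close> acts as \<open>2 A (k, \<partial>) A\<^sup>-\<^sup>1\<close>, so the highest term of the result is
  \<open>2\<^bsup>M\<^esup> A(x) (k, \<partial>)\<^bsup>M\<^esup> A(x) = 2\<^bsup>M\<^esup> M! A(x) A(k)\<close>.
\<close>

section \<open>Polynomials in two pairs of variables\<close>

type_synonym fn = "complex ^ 2 \<Rightarrow> complex ^ 2 \<Rightarrow> complex"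

text \<open>Building the span one monomial at a time makes its closure properties provable by rule
  induction. \<open>pspan_coeffs\<close> recovers the coefficient families required by
  \<open>homogeneous_poly\<close> and \<open>poly_deg_less\<close>.\<close>

inductive pspan :: "expo set \<Rightarrow> fn \<Rightarrow> bool" for S where
  zero: "pspan S (\<lambda>k x. 0)"
| add_mono: "pspan S f \<Longrightarrow> e \<in> S \<Longrightarrow> pspan S (\<lambda>k x. f k x + c * mono_eval e k x)"

abbreviation pol :: "fn \<Rightarrow> bool" where "pol \<equiv> pspan UNIV"
abbreviation pless :: "nat \<Rightarrow> fn \<Rightarrow> bool" where "pless d \<equiv> pspan {e. tdeg e < d}"
abbreviation phom :: "nat \<Rightarrow> fn \<Rightarrow> bool" where "phom d \<equiv> pspan {e. tdeg e = d}"

lemma pspan_coeffs: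
  assumes "pspan S f" "finite S"
  shows "\<exists>C. \<forall>k x. f k x = (\<Sum>e\<in>S. C e * mono_eval e k x)"
  using assms
proof induction
  case zero
  show ?case by (rule exI [of _ "\<lambda>_. 0"]) simp
next
  case (add_mono f e c)
  then obtain C where C: "\<And>k x. f k x = (\<Sum>e\<in>S. C e * mono_eval e k x)" by blast
  have "f k x + c * mono_eval e k x = (\<Sum>e'\<in>S. (C(e := C e + c)) e' * mono_eval e' k x)" for k x
    unfolding C sum.remove [OF \<open>finite S\<close> \<open>e \<in> S\<close>] by (simp add: algebra_simps)
  then show ?case by blast
qed

lemma pspan_mono: "pspan S f \<Longrightarrow> S \<subseteq> T \<Longrightarrow> pspan T f"
  by (induction rule: pspan.induct) (auto intro: pspan.intros)

lemma pspan_imp_pol: "pspan S f \<Longrightarrow> pol f"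
  by (rule pspan_mono) auto

lemma pspan_monomial: "e \<in> S \<Longrightarrow> pspan S (\<lambda>k x. c * mono_eval e k x)"
  using pspan.add_mono [OF pspan.zero, of e S c] by simp

lemma pspan_add: "pspan S g \<Longrightarrow> pspan S f \<Longrightarrow> pspan S (\<lambda>k x. f k x + g k x)"
  by (induction rule: pspan.induct) (auto intro: pspan.intros simp: add.assoc [symmetric])

lemma pspan_scale: "pspan S f \<Longrightarrow> pspan S (\<lambda>k x. c * f k x)"
proof (induction rule: pspan.induct)
  case (add_mono f e c')
  then show ?case
    using pspan.add_mono [OF add_mono.IH, of e "c * c'"] by (simp add: algebra_simps)
qed (auto intro: pspan.zero)

lemma pspan_diff: "pspan S f \<Longrightarrow> pspan S g \<Longrightarrow> pspan S (\<lambda>k x. f k x - g k x)"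
  using pspan_add [OF pspan_scale [of S g "-1"], of f] by simp

lemma pspan_sum: "(\<And>i. i \<in> I \<Longrightarrow> pspan S (f i)) \<Longrightarrow> pspan S (\<lambda>k x. \<Sum>i\<in>I. f i k x)"
  by (induction I rule: infinite_finite_induct) (auto intro: pspan.zero pspan_add)

lemma mono_eval_add: "mono_eval (e + e') k x = mono_eval e k x * mono_eval e' k x"
  by (cases e; cases e') (simp add: power_add)

lemma tdeg_add: "tdeg (e + e') = tdeg e + tdeg e'"
  by (cases e; cases e') simp

lemma pspan_mult:
  assumes "pspan S f" "pspan T g" and U: "\<And>e e'. e \<in> S \<Longrightarrow> e' \<in> T \<Longrightarrow> e + e' \<in> U"
  shows "pspan U (\<lambda>k x. f k x * g k x)"
  using assms(1)
proof induction
  case (add_mono f e c)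
  have "pspan U (\<lambda>k x. mono_eval e k x * g k x)"
    using assms(2)
  proof induction
    case (add_mono g e' c')
    then show ?case
      using pspan.add_mono [OF add_mono.IH U [OF \<open>e \<in> S\<close> \<open>e' \<in> T\<close>], of c']
      by (simp add: mono_eval_add algebra_simps)
  qed (auto intro: pspan.zero)
  from pspan_add [OF pspan_scale [OF this, of c] add_mono.IH] show ?case
    by (simp add: algebra_simps)
qed (auto intro: pspan.zero)

lemma pol_mult: "pol f \<Longrightarrow> pol g \<Longrightarrow> pol (\<lambda>k x. f k x * g k x)"
  by (rule pspan_mult) auto

lemma phom_mult: "phom a f \<Longrightarrow> phom b g \<Longrightarrow> phom (a + b) (\<lambda>k x. f k x * g k x)"
  by (rule pspan_mult) (auto simp: tdeg_add simp del: tdeg.simps)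

text \<open>The two bounds are asymmetric on purpose: degree at most \<open>a\<close> added to
  degree below \<open>b\<close> stays below \<open>a + b\<close>.\<close>

lemma pless_mult: "pless (Suc a) f \<Longrightarrow> pless b g \<Longrightarrow> pless (a + b) (\<lambda>k x. f k x * g k x)"
  by (rule pspan_mult) (auto simp: tdeg_add simp del: tdeg.simps)

lemma pless_mono: "pless a f \<Longrightarrow> a \<le> b \<Longrightarrow> pless b f"
  by (rule pspan_mono) auto

lemma phom_const: "phom 0 (\<lambda>k x. c)"
  using pspan_monomial [of "(0,0,0,0)" "{e. tdeg e = 0}" c] by simp

lemma phom_bil_k: "phom 1 (\<lambda>k x. bil v k)"
  using pspan_add [OF pspan_monomial [of "(0,1,0,0)" _ "v$2"] pspan_monomial [of "(1,0,0,0)" "{e. tdeg e = 1}" "v$1"]]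
  by (simp add: bil_def)

lemma phom_bil_x: "phom 1 (\<lambda>k x. bil v x)"
  using pspan_add [OF pspan_monomial [of "(0,0,0,1)" _ "v$2"] pspan_monomial [of "(0,0,1,0)" "{e. tdeg e = 1}" "v$1"]]
  by (simp add: bil_def)

lemma phom_power: "phom d f \<Longrightarrow> phom (n * d) (\<lambda>k x. f k x ^ n)"
  by (induction n) (auto intro: phom_const phom_mult)

lemma phom_prod:
  "(\<And>i. i \<in> I \<Longrightarrow> phom (d i) (f i)) \<Longrightarrow> phom (\<Sum>i\<in>I. d i) (\<lambda>k x. \<Prod>i\<in>I. f i k x)"
  by (induction I rule: infinite_finite_induct) (auto intro: phom_const phom_mult)

lemma phom_pless: "phom d f \<Longrightarrow> d < d' \<Longrightarrow> pless d' f"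
  by (rule pspan_mono) auto

lemmas pol_const = pspan_imp_pol [OF phom_const]
lemmas pol_bil_k = pspan_imp_pol [OF phom_bil_k]
lemmas pol_bil_x = pspan_imp_pol [OF phom_bil_x]

lemma pol_power: "pol f \<Longrightarrow> pol (\<lambda>k x. f k x ^ n)"
  by (induction n) (auto intro: pol_const pol_mult)

lemma pol_prod: "(\<And>i. i \<in> I \<Longrightarrow> pol (f i)) \<Longrightarrow> pol (\<lambda>k x. \<Prod>i\<in>I. f i k x)"
  by (induction I rule: infinite_finite_induct) (auto intro: pol_const pol_mult)

lemmas pol_intros = pol_const pol_bil_k pol_bil_x pol_mult pol_power pol_prod pspan_add
  pspan_diff pspan_sum pspan_scale

section \<open>Partial derivatives in \<open>x\<close> of polynomial functions\<close>

definition upd :: "2 \<Rightarrow> complex \<Rightarrow> complex ^ 2 \<Rightarrow> complex ^ 2" where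
  "upd i z x = (\<chi> j. if j = i then z else x $ j)"

lemma upd_self [simp]: "upd i (x $ i) x = x"
  by (simp add: upd_def vec_eq_iff)

definition PD :: "2 \<Rightarrow> fn \<Rightarrow> fn" where
  "PD i f = (\<lambda>k x. partial_deriv i (f k) x)"

lemma PD_eq: "PD i f k x = deriv (\<lambda>z. f k (upd i z x)) (x $ i)"
  by (simp add: PD_def partial_deriv_def upd_def)

lemma pol_differentiable: "pol f \<Longrightarrow> (\<lambda>z. f k (upd i z x)) field_differentiable at w"
proof (induction rule: pspan.induct)
  case (add_mono f e c)
  have "(\<lambda>z. mono_eval e k (upd i z x)) field_differentiable at w"
    using exhaust_2 [of i]
    by (cases e) (auto simp: upd_def intro!: derivative_intros)
  then show ?case
    using add_mono by (intro derivative_intros) auto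
qed (auto intro: derivative_intros)

lemma PD_const: "PD i (\<lambda>k x. c k) = (\<lambda>k x. 0)"
  by (simp add: PD_eq fun_eq_iff)

lemma PD_add: "pol f \<Longrightarrow> pol g \<Longrightarrow> PD i (\<lambda>k x. f k x + g k x) = (\<lambda>k x. PD i f k x + PD i g k x)"
  by (auto simp: fun_eq_iff PD_eq intro!: deriv_add pol_differentiable)

lemma PD_scale: "pol f \<Longrightarrow> PD i (\<lambda>k x. c k * f k x) = (\<lambda>k x. c k * PD i f k x)"
  by (auto simp: fun_eq_iff PD_eq intro!: deriv_cmult pol_differentiable)

lemma PD_mult: "pol f \<Longrightarrow> pol g \<Longrightarrow>
   PD i (\<lambda>k x. f k x * g k x) = (\<lambda>k x. f k x * PD i g k x + PD i f k x * g k x)"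
  by (auto simp: fun_eq_iff PD_eq pol_differentiable)

lemma PD_bil_x: "PD i (\<lambda>k x. bil v x) = (\<lambda>k x. v $ i)"
proof -
  have "((\<lambda>z. bil v (upd i z x)) has_field_derivative v $ i) (at w)" for x w
    using exhaust_2 [of i] by (auto simp: bil_def upd_def intro!: derivative_eq_intros)
  then show ?thesis
    by (auto simp: fun_eq_iff PD_eq intro: DERIV_imp_deriv)
qed

text \<open>At exponent 0 the truncated subtraction leaves the monomial unchanged; this is harmless
  because the accompanying coefficient \<open>emono\<close> is then 0.\<close>

fun dmono :: "2 \<Rightarrow> expo \<Rightarrow> expo" where
  "dmono i (a, b, c, d) = (if i = 1 then (a, b, c - 1, d) else (a, b, c, d - 1))"
fun emono :: "2 \<Rightarrow> expo \<Rightarrow> nat" where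
  "emono i (a, b, c, d) = (if i = 1 then c else d)"

lemma PD_mono: "PD i (\<lambda>k x. mono_eval e k x) = (\<lambda>k x. of_nat (emono i e) * mono_eval (dmono i e) k x)"
proof -
  have "((\<lambda>z. mono_eval e k (upd i z x)) has_field_derivative
      of_nat (emono i e) * mono_eval (dmono i e) k x) (at (x $ i))" for k x
    using exhaust_2 [of i]
    by (cases e) (auto simp: upd_def intro!: derivative_eq_intros)
  then show ?thesis
    by (auto simp: fun_eq_iff PD_eq intro: DERIV_imp_deriv)
qed

lemma pol_mono: "pol (mono_eval e)"
  using pspan_monomial [of e UNIV 1] by simp

lemma PD_add_mono: "pol f \<Longrightarrow> PD i (\<lambda>k x. f k x + c * mono_eval e k x) =
   (\<lambda>k x. PD i f k x + (c * of_nat (emono i e)) * mono_eval (dmono i e) k x)"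
  by (simp add: PD_add PD_scale PD_mono pol_mono pspan_scale mult.assoc)

lemma PD_pless: "pless (Suc d) f \<Longrightarrow> pless d (PD i f)"
proof (induction rule: pspan.induct)
  case zero
  then show ?case by (simp add: PD_const pspan.zero)
next
  case (add_mono f e c)
  show ?case
  proof (cases "emono i e = 0")
    case True
    then show ?thesis
      using add_mono by (simp add: PD_add_mono [OF pspan_imp_pol])
  next
    case False
    then have "tdeg (dmono i e) < d"
      using add_mono.hyps by (cases e) (auto split: if_splits)
    then show ?thesis
      using add_mono by (simp add: PD_add_mono [OF pspan_imp_pol] pspan.add_mono)
  qed
qed

lemma pol_PD: "pol f \<Longrightarrow> pol (PD i f)"
proof (induction rule: pspan.induct)
  case zero
  then show ?case by (simp add: PD_const pspan.zero)
next
  case (add_mono f e c)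
  then show ?case by (simp add: PD_add_mono pspan.add_mono)
qed

text \<open>Checked monomial by monomial, so the symmetry of mixed derivatives becomes an identity
  between exponents.\<close>

lemma PD_commute: "pol f \<Longrightarrow> PD i (PD j f) = PD j (PD i f)"
proof (induction rule: pspan.induct)
  case zero
  then show ?case by (simp add: PD_const)
next
  case (add_mono f e c)
  have "emono i e * emono j (dmono i e) = emono j e * emono i (dmono j e)"
    "dmono i (dmono j e) = dmono j (dmono i e)"
    by (cases e; auto)+
  then have "of_nat (emono i e) * of_nat (emono j (dmono i e)) =
      (of_nat (emono j e) * of_nat (emono i (dmono j e)) :: complex)"
    "dmono i (dmono j e) = dmono j (dmono i e)"
    by (metis of_nat_mult)+
  with add_mono show ?case by (simp add: PD_add_mono pol_PD) (simp add: mult.assoc)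
qed

text \<open>
  \<open>TD v\<close> is the derivative along \<open>v\<close> conjugated by \<open>e\<^bsup>(k,x)\<^esup>\<close>, so that it acts on the polynomial
  factor alone; \<open>KD\<close> is \<open>(k, \<partial>)\<close>.
\<close>

definition DD :: "(complex ^ 2 \<Rightarrow> complex ^ 2) \<Rightarrow> (complex ^ 2 \<Rightarrow> complex) \<Rightarrow> fn \<Rightarrow> fn" where
  "DD v c f = (\<lambda>k x. v k $ 1 * PD 1 f k x + v k $ 2 * PD 2 f k x + c k * f k x)"

abbreviation TD :: "complex ^ 2 \<Rightarrow> fn \<Rightarrow> fn" where "TD v \<equiv> DD (\<lambda>k. v) (bil v)"
abbreviation KD :: "fn \<Rightarrow> fn" where "KD \<equiv> DD (\<lambda>k. k) (\<lambda>k. 0)"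

lemma bil_axis: "k $ i = bil (axis i 1) k"
  using exhaust_2 [of i] by (auto simp: bil_def axis_def)

lemma pol_k: "pol (\<lambda>k x. k $ i)"
  unfolding bil_axis by (rule pol_bil_k)

section \<open>Leibniz rules for the conjugated derivatives and their iterates\<close>

lemma DD_add: "pol f \<Longrightarrow> pol g \<Longrightarrow> DD v c (\<lambda>k x. f k x + g k x) = (\<lambda>k x. DD v c f k x + DD v c g k x)"
  by (simp add: DD_def PD_add fun_eq_iff algebra_simps)

lemma DD_scale: "pol f \<Longrightarrow> DD v c (\<lambda>k x. b k * f k x) = (\<lambda>k x. b k * DD v c f k x)"
  by (simp add: DD_def PD_scale fun_eq_iff algebra_simps)

text \<open>The zeroth-order part \<open>c\<close> commutes with multiplication by a linear form, so
  the only extra term is the derivative of \<open>bil a x\<close> along \<open>v k\<close>.\<close>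

lemma DD_lin: "pol f \<Longrightarrow> DD v c (\<lambda>k x. bil a x * f k x) =
   (\<lambda>k x. bil a x * DD v c f k x + bil a (v k) * f k x)"
  by (simp add: DD_def PD_mult pol_bil_x PD_bil_x fun_eq_iff algebra_simps) (simp add: bil_def algebra_simps)

lemma KD_mult: "pol f \<Longrightarrow> pol g \<Longrightarrow>
  KD (\<lambda>k x. f k x * g k x) = (\<lambda>k x. f k x * KD g k x + KD f k x * g k x)"
  by (simp add: DD_def PD_mult fun_eq_iff algebra_simps)

lemma TD_commute: "pol f \<Longrightarrow> TD v (TD w f) = TD w (TD v f)"
  by (simp add: DD_def PD_add PD_scale pol_PD pol_intros fun_eq_iff PD_commute [of f 1 2])
     (simp add: algebra_simps)

lemma DD_const: "DD v c (\<lambda>k x. b k) = (\<lambda>k x. c k * b k)"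
  by (simp add: DD_def PD_const)

lemma pol_DD:
  fixes v :: "complex ^ 2 \<Rightarrow> complex ^ 2"
  assumes "\<And>i. pol (\<lambda>k x. v k $ i)" "pol (\<lambda>k x. c k)" "pol f"
  shows "pol (DD v c f)"
  unfolding DD_def by (intro pol_intros pol_PD assms)

text \<open>\<open>TD v\<close> and \<open>KD\<close> are treated together: all that matters is that
  the coefficients are polynomials in \<open>k\<close> alone.\<close>

context
  fixes v :: "complex ^ 2 \<Rightarrow> complex ^ 2" and c :: "complex ^ 2 \<Rightarrow> complex"
  assumes pol_coeffs: "\<And>i. pol (\<lambda>k x. v k $ i)" "pol (\<lambda>k x. c k)"
begin

lemma pol_DD_funpow: "pol f \<Longrightarrow> pol ((DD v c ^^ n) f)"
  by (induction n) (auto intro: pol_DD [OF pol_coeffs])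

lemma DD_funpow_add: "pol f \<Longrightarrow> pol g \<Longrightarrow>
  (DD v c ^^ n) (\<lambda>k x. f k x + g k x) = (\<lambda>k x. (DD v c ^^ n) f k x + (DD v c ^^ n) g k x)"
  by (induction n) (simp_all add: DD_add pol_DD_funpow)

lemma DD_funpow_scale: "pol f \<Longrightarrow>
  (DD v c ^^ n) (\<lambda>k x. b k * f k x) = (\<lambda>k x. b k * (DD v c ^^ n) f k x)"
  by (induction n) (simp_all add: DD_scale pol_DD_funpow)

lemma DD_funpow_diff:
  assumes "pol f" "pol g"
  shows "(DD v c ^^ n) (\<lambda>k x. f k x - g k x) = (\<lambda>k x. (DD v c ^^ n) f k x - (DD v c ^^ n) g k x)"
proof -
  have "(DD v c ^^ n) (\<lambda>k x. f k x + (-1) * g k x) =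
      (\<lambda>k x. (DD v c ^^ n) f k x + (-1) * (DD v c ^^ n) g k x)"
    unfolding DD_funpow_add [OF assms(1) pspan_scale [OF assms(2)]] DD_funpow_scale [OF assms(2)] ..
  then show ?thesis by simp
qed

lemma DD_funpow_zero: "(DD v c ^^ n) (\<lambda>k x. 0) = (\<lambda>k x. 0)"
  by (induction n) (simp_all add: DD_const)

lemma DD_funpow_sum: "(\<And>i. i \<in> I \<Longrightarrow> pol (f i)) \<Longrightarrow>
  (DD v c ^^ n) (\<lambda>k x. \<Sum>i\<in>I. f i k x) = (\<lambda>k x. \<Sum>i\<in>I. (DD v c ^^ n) (f i) k x)"
  by (induction I rule: infinite_finite_induct)
    (simp_all add: DD_funpow_add DD_funpow_zero pspan_sum)

text \<open>The Leibniz expansion stops after two terms because the derivative of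
  \<open>bil a x\<close> does not depend on \<open>x\<close>. For \<open>n = 0\<close> the index
  \<open>n - 1\<close> is truncated, but its coefficient is 0.\<close>

lemma DD_lin_funpow:
  assumes f: "pol f"
  shows "(DD v c ^^ n) (\<lambda>k x. bil a x * f k x) =
    (\<lambda>k x. bil a x * (DD v c ^^ n) f k x + of_nat n * bil a (v k) * (DD v c ^^ (n - 1)) f k x)"
proof (induction n)
  case (Suc n)
  let ?F = "\<lambda>n. (DD v c ^^ n) f"
  let ?b = "\<lambda>k. of_nat n * bil a (v k)"
  have pol: "pol (?F i)" for i
    using f by (rule pol_DD_funpow)
  have pol2: "pol (\<lambda>k x. bil a x * ?F n k x)"
    by (intro pol_intros pol)
  \<comment> \<open>By the induction hypothesis the second Leibniz term is this difference, which
    gives its polynomiality without any expansion of \<open>bil a (v k)\<close>.\<close>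
  have "pol (\<lambda>k x. (DD v c ^^ n) (\<lambda>k x. bil a x * f k x) k x - bil a x * ?F n k x)"
    by (intro pol_intros pol_DD_funpow f)
  then have pol3: "pol (\<lambda>k x. ?b k * ?F (n - 1) k x)"
    by (simp only: Suc.IH add_diff_cancel_left')
  have F: "of_nat n * DD v c (?F (n - 1)) k x = of_nat n * ?F n k x" for k x
    by (cases n) simp_all
  have "(DD v c ^^ Suc n) (\<lambda>k x. bil a x * f k x) =
      DD v c (\<lambda>k x. bil a x * ?F n k x + ?b k * ?F (n - 1) k x)"
    by (simp only: funpow.simps o_apply Suc.IH)
  also have "\<dots> = (\<lambda>k x. (bil a x * DD v c (?F n) k x + bil a (v k) * ?F n k x) +
      ?b k * DD v c (?F (n - 1)) k x)"
    by (simp only: DD_add [OF pol2 pol3] DD_lin [OF pol] DD_scale [OF pol])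
  also have "\<dots> = (\<lambda>k x. bil a x * ?F (Suc n) k x + of_nat (Suc n) * bil a (v k) * ?F n k x)"
  proof (intro ext)
    fix k x
    have "?b k * DD v c (?F (n - 1)) k x = bil a (v k) * (of_nat n * ?F n k x)"
      by (simp only: F [symmetric] ac_simps)
    then show "(bil a x * DD v c (?F n) k x + bil a (v k) * ?F n k x) + ?b k * DD v c (?F (n - 1)) k x =
        bil a x * ?F (Suc n) k x + of_nat (Suc n) * bil a (v k) * ?F n k x"
      by (simp add: algebra_simps)
  qed
  finally show ?case by simp
qed simp

end

lemmas pol_TD = pol_DD [OF pol_const pol_bil_k]
  and pol_KD = pol_DD [OF pol_k pol_const]
  and TD_funpow_add = DD_funpow_add [OF pol_const pol_bil_k]
  and TD_funpow_diff = DD_funpow_diff [OF pol_const pol_bil_k]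
  and TD_funpow_scale = DD_funpow_scale [OF pol_const pol_bil_k]
  and TD_funpow_sum = DD_funpow_sum [OF pol_const pol_bil_k]
  and TD_lin_funpow = DD_lin_funpow [OF pol_const pol_bil_k]
  and KD_lin_funpow = DD_lin_funpow [OF pol_k pol_const]
  and pol_TD_funpow = pol_DD_funpow [OF pol_const pol_bil_k]
  and pol_KD_funpow = pol_DD_funpow [OF pol_k pol_const]

lemma TD_funpow_commute: "pol f \<Longrightarrow> (TD v ^^ n) (TD w f) = TD w ((TD v ^^ n) f)"
  by (induction n) (simp_all add: TD_commute [of _ v w] pol_TD_funpow)

section \<open>Divisibility by a linear form\<close>

lemma pol_imp_pless:
  assumes "pol f"
  shows "\<exists>d. pless d f"
  using assms
proof induction
  case zero
  then show ?case by (auto intro: pspan.zero)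
next
  case (add_mono f e c)
  then obtain d where "pless d f" by blast
  then have "pless (max d (Suc (tdeg e))) (\<lambda>k x. f k x + c * mono_eval e k x)"
    by (intro pspan.add_mono) (auto intro: pspan_mono)
  then show ?case by blast
qed

text \<open>Substituting for the coordinate \<open>x $ i\<close> the value that places \<open>x\<close> on the hyperplane.\<close>

lemma pless_subst_hyperplane:
  assumes "pless (Suc d) f" and i: "a $ i \<noteq> 0"
  shows "\<exists>g. pless d g \<and> (\<forall>k x. f k x - f k (upd i (x $ i - bil a x / a $ i) x) = bil a x * g k x)"
  using assms(1)
proof induction
  case zero
  then show ?case by (auto intro!: exI [of _ "\<lambda>k x. 0"] pspan.zero)
next
  case (add_mono f e c)
  then obtain g where g: "pless d g"
    "\<And>k x. f k x - f k (upd i (x $ i - bil a x / a $ i) x) = bil a x * g k x" by blast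
  obtain p q r s where e: "e = (p, q, r, s)" by (cases e)
  have "\<exists>h. pless d h \<and> (\<forall>k x. mono_eval e k x - mono_eval e k (upd i (x $ i - bil a x / a $ i) x) = bil a x * h k x)"
  proof (cases "i = 1")
    case True
    \<comment> \<open>The hyperplane is \<open>x $ 1 = t * x $ 2\<close>, and \<open>h\<close> is
      the geometric-sum quotient of the difference of \<open>r\<close>-th powers, times the rest of
      the monomial. One degree is lost to the linear factor.\<close>
    define t where "t = - a $ 2 / a $ 1"
    define h where "h = (\<lambda>k x. \<Sum>j<r. t ^ (r - Suc j) / a $ 1 * mono_eval (p, q, j, s + (r - Suc j)) k x)"
    have "pless d h"
      unfolding h_def using add_mono.hyps by (intro pspan_sum pspan_monomial) (auto simp: e)
    moreover have "mono_eval e k x - mono_eval e k (upd i (x $ i - bil a x / a $ i) x) = bil a x * h k x" for k x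
    proof -
      have y: "x $ 1 - bil a x / a $ 1 = t * x $ 2" and z: "x $ 1 - t * x $ 2 = bil a x / a $ 1"
        using i True by (simp_all add: bil_def t_def field_simps)
      have "x $ 1 ^ r - (t * x $ 2) ^ r = (x $ 1 - t * x $ 2) * (\<Sum>j<r. (t * x $ 2) ^ (r - Suc j) * x $ 1 ^ j)"
        by (rule power_diff_sumr2)
      then have "(k $ 1 ^ p * k $ 2 ^ q * x $ 2 ^ s) * (x $ 1 ^ r - (t * x $ 2) ^ r) = bil a x * h k x"
        unfolding z h_def mono_eval.simps power_add power_mult_distrib sum_distrib_left
        by (simp add: sum_distrib_left ac_simps)
      then show ?thesis
        unfolding e True mono_eval.simps y by (simp add: upd_def algebra_simps)
    qed
    ultimately show ?thesis by blast
  next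
    case False
    then have i2: "i = 2" using exhaust_2 [of i] by auto
    define t where "t = - a $ 1 / a $ 2"
    define h where "h = (\<lambda>k x. \<Sum>j<s. t ^ (s - Suc j) / a $ 2 * mono_eval (p, q, r + (s - Suc j), j) k x)"
    have "pless d h"
      unfolding h_def using add_mono.hyps by (intro pspan_sum pspan_monomial) (auto simp: e)
    moreover have "mono_eval e k x - mono_eval e k (upd i (x $ i - bil a x / a $ i) x) = bil a x * h k x" for k x
    proof -
      have y: "x $ 2 - bil a x / a $ 2 = t * x $ 1" and z: "x $ 2 - t * x $ 1 = bil a x / a $ 2"
        using i i2 by (simp_all add: bil_def t_def field_simps)
      have "x $ 2 ^ s - (t * x $ 1) ^ s = (x $ 2 - t * x $ 1) * (\<Sum>j<s. (t * x $ 1) ^ (s - Suc j) * x $ 2 ^ j)"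
        by (rule power_diff_sumr2)
      then have "(k $ 1 ^ p * k $ 2 ^ q * x $ 1 ^ r) * (x $ 2 ^ s - (t * x $ 1) ^ s) = bil a x * h k x"
        unfolding z h_def mono_eval.simps power_add power_mult_distrib sum_distrib_left
        by (simp add: sum_distrib_left ac_simps)
      then show ?thesis
        unfolding e i2 mono_eval.simps y by (simp add: upd_def algebra_simps)
    qed
    ultimately show ?thesis by blast
  qed
  then obtain h where h: "pless d h"
    "\<And>k x. mono_eval e k x - mono_eval e k (upd i (x $ i - bil a x / a $ i) x) = bil a x * h k x"
    by blast
  let ?u = "\<lambda>x. upd i (x $ i - bil a x / a $ i) x"
  let ?l = "\<lambda>k x. f k x + c * mono_eval e k x - (f k (?u x) + c * mono_eval e k (?u x))"
  show ?case
  proof (intro exI conjI allI)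
    show "pless d (\<lambda>k x. g k x + c * h k x)"
      using g h by (intro pspan_add pspan_scale)
    show "f k x + c * mono_eval e k x - (f k (upd i (x $ i - bil a x / a $ i) x) +
        c * mono_eval e k (upd i (x $ i - bil a x / a $ i) x)) = bil a x * (g k x + c * h k x)" for k x
    proof -
      have "?l k x = (f k x - f k (?u x)) + c * (mono_eval e k x - mono_eval e k (?u x))"
        by (simp add: algebra_simps)
      then show ?thesis
        unfolding g(2) h(2) by (simp add: algebra_simps)
    qed
  qed
qed

text \<open>After moving \<open>x\<close> onto the hyperplane the value of \<open>f\<close> is 0, so
  \<open>f\<close> equals the difference of the two values, and that difference carries the factor
  \<open>bil a x\<close>.\<close>

lemma pless_divide:
  assumes "pless (Suc d) f" "a \<noteq> 0" "\<And>k x. bil a x = 0 \<Longrightarrow> f k x = 0"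
  shows "\<exists>g. pless d g \<and> f = (\<lambda>k x. bil a x * g k x)"
proof -
  obtain i where i: "a $ i \<noteq> 0" using assms(2) by (auto simp: vec_eq_iff)
  have on: "bil a (upd i (x $ i - bil a x / a $ i) x) = 0" for x
  proof (cases "i = 1")
    case True
    with i show ?thesis by (simp add: bil_def upd_def field_simps)
  next
    case False
    then have "i = 2" using exhaust_2 [of i] by auto
    with i show ?thesis by (simp add: bil_def upd_def field_simps)
  qed
  obtain g where g: "pless d g"
    "\<And>k x. f k x - f k (upd i (x $ i - bil a x / a $ i) x) = bil a x * g k x"
    using pless_subst_hyperplane [OF assms(1) i] by blast
  have "f = (\<lambda>k x. bil a x * g k x)"
    by (intro ext) (simp only: g(2) [symmetric] assms(3) [OF on] diff_zero)
  with g(1) show ?thesis by blast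
qed

text \<open>Write \<open>f\<close> as \<open>bil a x * g\<close>; a derivative along
  \<open>b\<close> does not hit the linear factor when \<open>bil a b = 0\<close>, so the factor
  survives.\<close>

lemma TD_tangential:
  assumes "pol f" "a \<noteq> 0" "bil a b = 0" "\<And>k x. bil a x = 0 \<Longrightarrow> f k x = 0" "bil a x = 0"
  shows "TD b f k x = 0"
proof -
  obtain d where "pless (Suc d) f"
    using pol_imp_pless [OF assms(1)] pless_mono by (meson lessI less_imp_le)
  then obtain g where g: "pless d g" "f = (\<lambda>k x. bil a x * g k x)"
    using pless_divide assms by blast
  then show ?thesis
    using assms by (simp add: DD_lin pspan_imp_pol)
qed

lemma pol_continuous:
  assumes "pol f"
  shows "continuous_on UNIV (\<lambda>s. f k (s *s b))"
  using assms
proof induction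
  case (add_mono f e c)
  have "continuous_on UNIV (\<lambda>s. mono_eval e k (s *s b))"
    by (cases e) (auto intro!: continuous_intros)
  with add_mono show ?case by (intro continuous_intros)
qed auto

text \<open>Computations on a line divide by the parameter \<open>s\<close>; continuity recovers the
  origin.\<close>

lemma pol_vanish_zero:
  assumes "pol f" "\<And>s. s \<noteq> 0 \<Longrightarrow> f k (s *s b) = 0"
  shows "f k (s *s b) = 0"
proof (cases "s = 0")
  case True
  have "((\<lambda>s. f k (s *s b)) \<longlongrightarrow> f k (0 *s b)) (at 0)"
    using pol_continuous [OF assms(1), unfolded continuous_on] by blast
  moreover have "((\<lambda>s. f k (s *s b)) \<longlongrightarrow> 0) (at 0)"
    using assms(2) by (intro tendsto_eventually) (auto simp: eventually_at_filter)
  ultimately show ?thesis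
    using True LIM_unique by blast
qed (use assms in auto)

section \<open>The derivative along \<open>k\<close> on products of linear forms\<close>

lemma KD_power: "KD (\<lambda>k x. bil a x ^ n) = (\<lambda>k x. of_nat n * bil a k * bil a x ^ (n - 1))"
proof (induction n)
  case 0
  show ?case by (simp add: DD_const)
next
  case (Suc n)
  have "KD (\<lambda>k x. bil a x * bil a x ^ n) =
      (\<lambda>k x. bil a x * (of_nat n * bil a k * bil a x ^ (n - 1)) + bil a k * bil a x ^ n)"
    by (subst DD_lin) (intro pol_intros, simp only: Suc.IH)
  also have "\<dots> = (\<lambda>k x. of_nat (Suc n) * bil a k * bil a x ^ (Suc n - 1))"
    by (cases n) (simp_all add: fun_eq_iff algebra_simps)
  finally show ?case by simp
qed

lemma KD_prod:
  assumes "finite J"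
  shows "KD (\<lambda>k x. \<Prod>i\<in>J. bil (\<alpha> i) x ^ m i) = (\<lambda>k x. \<Sum>i\<in>J. of_nat (m i) *
    (bil (\<alpha> i) k * (bil (\<alpha> i) x ^ (m i - 1) * (\<Prod>j\<in>J - {i}. bil (\<alpha> j) x ^ m j))))"
  using assms
proof induction
  case empty
  show ?case by (simp add: DD_const)
next
  case (insert j J)
  have "(\<Prod>i\<in>insert j J - {i}. bil (\<alpha> i) x ^ m i) =
      bil (\<alpha> j) x ^ m j * (\<Prod>i\<in>J - {i}. bil (\<alpha> i) x ^ m i)" if "i \<in> J" for i and x
  proof -
    have "insert j J - {i} = insert j (J - {i})" using insert that by auto
    then show ?thesis using insert by simp
  qed
  moreover have "insert j J - {j} = J" using insert by auto
  ultimately show ?case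
    using insert by (simp add: KD_mult pol_intros KD_power fun_eq_iff sum_distrib_left sum_distrib_right
        algebra_simps cong: sum.cong)
qed

text \<open>Once \<open>n\<close> derivatives have made \<open>f\<close> independent of
  \<open>x\<close>, one more derivative per linear factor suffices: the term with that factor
  undifferentiated vanishes, and the Leibniz coefficient extends the factorial.\<close>

lemma KD_funpow_lin_top:
  assumes "pol f" "(KD ^^ n) f = (\<lambda>k x. fact n * c k)"
  shows "(KD ^^ (p + n)) (\<lambda>k x. bil a x ^ p * f k x) = (\<lambda>k x. fact (p + n) * (bil a k ^ p * c k))"
proof (induction p)
  case (Suc p)
  let ?f = "\<lambda>k x. bil a x ^ p * f k x"
  have pol: "pol ?f"
    by (intro pol_intros assms)
  have "(KD ^^ (Suc p + n)) (\<lambda>k x. bil a x ^ Suc p * f k x) =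
      (KD ^^ Suc (p + n)) (\<lambda>k x. bil a x * ?f k x)"
    by (simp only: power_Suc mult.assoc add_Suc)
  also have "\<dots> = (\<lambda>k x. bil a x * KD ((KD ^^ (p + n)) ?f) k x +
      of_nat (Suc (p + n)) * bil a k * (KD ^^ (p + n)) ?f k x)"
    using KD_lin_funpow [OF pol, where n = "Suc (p + n)" and a = a] by (simp only: diff_Suc_1 funpow.simps o_apply)
  also have "\<dots> = (\<lambda>k x. fact (Suc p + n) * (bil a k ^ Suc p * c k))"
    unfolding Suc.IH DD_const
    by (simp add: fun_eq_iff algebra_simps)
  finally show ?case .
qed (use assms in simp)

text \<open>An instance of the polarization fact that the \<open>M\<close>-fold derivative along
  \<open>k\<close> of a form of degree \<open>M\<close> is \<open>fact M\<close> times its value at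
  \<open>k\<close>.\<close>

lemma KD_funpow_prod:
  assumes "finite J"
  shows "(KD ^^ (\<Sum>i\<in>J. m i)) (\<lambda>k x. \<Prod>i\<in>J. bil (\<alpha> i) x ^ m i) =
    (\<lambda>k x. fact (\<Sum>i\<in>J. m i) * (\<Prod>i\<in>J. bil (\<alpha> i) k ^ m i))"
  using assms
proof induction
  case (insert j J)
  show ?case
    unfolding prod.insert [OF insert.hyps] sum.insert [OF insert.hyps]
    by (rule KD_funpow_lin_top [OF _ insert.IH]) (intro pol_intros)
qed simp

section \<open>Quasi-invariance\<close>

text \<open>The tangential direction of the line \<open>bil a x = 0\<close>. For non-isotropic
  \<open>a\<close>, \<open>bil v (perp a)\<close> vanishes exactly when \<open>v\<close> is
  proportional to \<open>a\<close>.\<close>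

definition perp :: "complex ^ 2 \<Rightarrow> complex ^ 2" where
  "perp a = vector [- (a $ 2), a $ 1]"

lemma perp_nth [simp]: "perp a $ 1 = - (a $ 2)" "perp a $ 2 = a $ 1"
  by (simp_all add: perp_def)

lemma bil_perp [simp]: "bil a (perp a) = 0"
  by (simp add: bil_def)

lemma on_hyperplane:
  assumes "bil a x = 0" "bil a a \<noteq> 0"
  shows "x = (bil (perp a) x / bil a a) *s perp a"
proof -
  have "bil a a * x $ 1 = bil (perp a) x * perp a $ 1 + bil a x * a $ 1"
    "bil a a * x $ 2 = bil (perp a) x * perp a $ 2 + bil a x * a $ 2"
    by (simp_all add: bil_def algebra_simps)
  with assms show ?thesis
    by (simp add: vec_eq_iff forall_2 field_simps)
qed

section \<open>Normal and tangential derivatives\<close>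

lemma TD_decomp:
  "bil a a * TD v f k x = bil v a * TD a f k x + bil v (perp a) * TD (perp a) f k x"
  by (simp add: DD_def bil_def algebra_simps)

lemma TD_TD:
  assumes "pol f"
  shows "TD v (TD w f) k x = v $ 1 * w $ 1 * PD 1 (PD 1 f) k x +
    (v $ 1 * w $ 2 + v $ 2 * w $ 1) * PD 2 (PD 1 f) k x + v $ 2 * w $ 2 * PD 2 (PD 2 f) k x +
    bil w k * (v $ 1 * PD 1 f k x + v $ 2 * PD 2 f k x) +
    bil v k * (w $ 1 * PD 1 f k x + w $ 2 * PD 2 f k x) + bil v k * bil w k * f k x"
  using assms
  by (simp add: DD_def PD_add PD_scale pol_PD pol_intros PD_commute [of f 1 2])
    (simp add: algebra_simps)

text \<open>The bracket is the Laplacian conjugated by the exponential. The vectors \<open>a\<close>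
  and \<open>perp a\<close> are orthogonal with equal squares, so it splits into a normal and a
  tangential part.\<close>

lemma lap_decomp:
  assumes "pol f"
  shows "bil a a * (PD 1 (PD 1 f) k x + PD 2 (PD 2 f) k x + 2 * KD f k x + bil k k * f k x) =
    TD a (TD a f) k x + TD (perp a) (TD (perp a) f) k x"
  unfolding TD_TD [OF assms] by (simp add: DD_def bil_def algebra_simps)

text \<open>
  The operator \<open>L - k\<^sup>2\<close> conjugated by \<open>e\<^bsup>(k,x)\<^esup>\<close>; the polynomials \<open>h i\<close> stand for the quotients
  \<open>TD (\<alpha> i) f / bil (\<alpha> i) x\<close>.
\<close>

definition BA_step :: "'i set \<Rightarrow> ('i \<Rightarrow> nat) \<Rightarrow> ('i \<Rightarrow> fn) \<Rightarrow> fn \<Rightarrow> fn" where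
  "BA_step I m h f = (\<lambda>k x. PD 1 (PD 1 f) k x + PD 2 (PD 2 f) k x + 2 * KD f k x -
     2 * (\<Sum>i\<in>I. of_nat (m i) * h i k x))"

text \<open>The Baker-Akhiezer condition on one line for the function
  \<open>f k x * exp (bil k x)\<close>, expressed through its polynomial factor.\<close>

definition quasi_inv :: "complex ^ 2 \<Rightarrow> nat \<Rightarrow> fn \<Rightarrow> bool" where
  "quasi_inv a m f \<longleftrightarrow>
     (\<forall>j k x. odd j \<longrightarrow> j < 2 * m \<longrightarrow> bil a x = 0 \<longrightarrow> (TD a ^^ j) f k x = 0)"

text \<open>As generating functions, \<open>H\<close> is \<open>W\<close> divided by
  \<open>L + P * t\<close>; the sum is the Cauchy product with the geometric series.\<close>

lemma linear_recurrence:
  fixes H W :: "nat \<Rightarrow> complex"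
  assumes "L \<noteq> 0" "L * H 0 = W 0" "\<And>j. L * H (Suc j) + P * H j = W (Suc j)"
  shows "H j = (\<Sum>l\<le>j. (- (P / L)) ^ l * (W (j - l) / L))"
proof (induction j)
  case 0
  then show ?case using assms(1,2) by (simp add: field_simps)
next
  case (Suc j)
  have "H (Suc j) = W (Suc j) / L + (- (P / L)) * H j"
    using assms(1) assms(3) [of j] by (simp add: field_simps)
  also have "\<dots> = (\<Sum>l\<le>Suc j. (- (P / L)) ^ l * (W (Suc j - l) / L))"
    unfolding sum.atMost_Suc_shift by (simp add: Suc.IH sum_distrib_left mult.assoc)
  finally show ?case .
qed

text \<open>
  Expanding \<open>1 / (\<alpha>\<^sub>i, x)\<close> in powers of the normal coordinate pairs each normal derivative of \<open>f\<close>
  with one of the sums in \<open>cot\<close>; by parity, one of the two factors vanishes.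
\<close>

lemma off_diagonal_terms:
  fixes \<alpha> :: "'i \<Rightarrow> complex ^ 2" and a :: "complex ^ 2"
  defines "b \<equiv> perp a"
  assumes nz: "bil a a \<noteq> 0" and nzi: "\<And>i. i \<in> J \<Longrightarrow> bil (\<alpha> i) b \<noteq> 0"
    and cot: "\<And>l. odd l \<Longrightarrow> l < 2 * n \<Longrightarrow>
      (\<Sum>i\<in>J. of_nat (m i) * (bil (\<alpha> i) a / bil (\<alpha> i) b) ^ l) = 0"
    and f: "pol f" "quasi_inv a n f"
    and h: "\<And>i. i \<in> J \<Longrightarrow> pol (h i)"
      "\<And>i. i \<in> J \<Longrightarrow> TD (\<alpha> i) f = (\<lambda>k x. bil (\<alpha> i) x * h i k x)"
    and j: "odd j" "j < 2 * n" and s: "s \<noteq> 0"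
  shows "(\<Sum>i\<in>J. of_nat (m i) * (TD a ^^ j) (h i) k (s *s b)) = 0"
proof -
  define x where "x = s *s b"
  define N where "N = bil a a"
  \<comment> \<open>\<open>U r\<close> and \<open>V r\<close> are normalized \<open>r\<close>-th
    normal derivatives of \<open>TD a f\<close> and \<open>TD b f\<close> at \<open>x\<close>. In
    the range considered, quasi-invariance kills \<open>U\<close> at even \<open>r\<close>, and
    \<open>V\<close> at odd \<open>r\<close> because the odd normal derivatives vanish along the
    whole line. \<open>\<rho> i\<close> is the cotangent of the angle between the two
    vectors.\<close>
  define U where "U = (\<lambda>r. (TD a ^^ Suc r) f k x / fact r)"
  define V where "V = (\<lambda>r. TD b ((TD a ^^ r) f) k x / fact r)"
  define \<rho> where "\<rho> = (\<lambda>i. bil (\<alpha> i) a / bil (\<alpha> i) b)"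
  have ax: "bil a x = 0"
    by (simp add: x_def b_def bil_def)
  have a0: "a \<noteq> 0" using nz by (auto simp: bil_def)
  have U0: "U r = 0" if "even r" "Suc r < 2 * n" for r
    using f(2) that ax by (auto simp: U_def quasi_inv_def simp del: funpow.simps)
  have V0: "V r = 0" if "odd r" "r < 2 * n" for r
  proof -
    have "TD b ((TD a ^^ r) f) k x = 0"
      by (rule TD_tangential [OF pol_TD_funpow [OF f(1)] a0 _ _ ax])
        (use f(2) that in \<open>auto simp: b_def quasi_inv_def\<close>)
    then show ?thesis by (simp add: V_def)
  qed
  have H: "(TD a ^^ j) (h i) k x / fact j =
      (\<Sum>l\<le>j. (- 1 / s) ^ l / (N * s) * (\<rho> i ^ Suc l * U (j - l) + \<rho> i ^ l * V (j - l)))"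
    if i: "i \<in> J" for i
  proof -
    define p where "p = bil (\<alpha> i) a"
    define c where "c = bil (\<alpha> i) b"
    define W where "W = (\<lambda>r. (p * U r + c * V r) / N)"
    define H where "H = (\<lambda>r. (TD a ^^ r) (h i) k x / fact r)"
    have N: "N \<noteq> 0" and c: "c \<noteq> 0"
      using nz nzi i by (auto simp: N_def c_def)
    have L: "bil (\<alpha> i) x = s * c"
      by (simp add: x_def c_def bil_def algebra_simps)
    have "(\<lambda>k x. bil (\<alpha> i) x * h i k x) = (\<lambda>k x. (p / N) * TD a f k x + (c / N) * TD b f k x)"
    proof (intro ext)
      fix k x
      have "N * TD (\<alpha> i) f k x = p * TD a f k x + c * TD b f k x"
        unfolding N_def p_def c_def b_def by (rule TD_decomp)
      with N show "bil (\<alpha> i) x * h i k x = (p / N) * TD a f k x + (c / N) * TD b f k x"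
        unfolding h(2) [OF i] by (simp add: field_simps)
    qed
    then have "(TD a ^^ r) (\<lambda>k x. bil (\<alpha> i) x * h i k x) k x =
        (p / N) * (TD a ^^ Suc r) f k x + (c / N) * TD b ((TD a ^^ r) f) k x" for r
      by (simp add: TD_funpow_add TD_funpow_scale pspan_scale pol_TD f TD_funpow_commute
          del: times_divide_eq_left)
    moreover have "(TD a ^^ r) (\<lambda>k x. bil (\<alpha> i) x * h i k x) k x =
        s * c * (TD a ^^ r) (h i) k x + of_nat r * p * (TD a ^^ (r - 1)) (h i) k x" for r
      by (subst TD_lin_funpow [OF h(1) [OF i]]) (simp_all add: L p_def)
    moreover have "fact r * W r = (p / N) * (TD a ^^ Suc r) f k x + (c / N) * TD b ((TD a ^^ r) f) k x" for r
      using N by (simp add: W_def U_def V_def field_simps)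
    \<comment> \<open>The \<open>r\<close>-th normal derivative of \<open>TD (\<alpha> i) f\<close>
      is computed twice: through \<open>h i\<close> and through the normal and tangential parts of
      \<open>\<alpha> i\<close>. Division by \<open>fact r\<close> gives the two-term
      recurrence.\<close>
    ultimately have rec: "s * c * (TD a ^^ r) (h i) k x + of_nat r * p * (TD a ^^ (r - 1)) (h i) k x =
        fact r * W r" for r
      by simp
    have "H j = (\<Sum>l\<le>j. (- (p / (s * c))) ^ l * (W (j - l) / (s * c)))"
    proof (rule linear_recurrence)
      show "s * c \<noteq> 0" using s c by simp
      show "s * c * H 0 = W 0" using rec [of 0] by (simp add: H_def)
      show "s * c * H (Suc r) + p * H r = W (Suc r)" for r
      proof -
        have "s * c * H (Suc r) + p * H r =
          (s * c * (TD a ^^ Suc r) (h i) k x + of_nat (Suc r) * p * (TD a ^^ r) (h i) k x) / fact (Suc r)"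
          by (simp add: H_def add_divide_distrib del: funpow.simps of_nat_Suc)
        also have "\<dots> = W (Suc r)"
          using rec [of "Suc r"] by (simp del: funpow.simps of_nat_Suc fact_Suc)
        finally show ?thesis .
      qed
    qed
    also have "\<dots> = (\<Sum>l\<le>j. (- 1 / s) ^ l / (N * s) * (\<rho> i ^ Suc l * U (j - l) + \<rho> i ^ l * V (j - l)))"
    proof (rule sum.cong [OF refl])
      fix l
      have \<rho>: "\<rho> i = p / c" by (simp add: \<rho>_def p_def c_def)
      have "(- (p / (s * c))) ^ l = (- 1 / s) ^ l * \<rho> i ^ l"
        by (simp add: \<rho> power_mult_distrib [symmetric])
      moreover have "W (j - l) / (s * c) = (\<rho> i * U (j - l) + V (j - l)) / (N * s)"
        using c s N by (simp add: W_def \<rho> field_simps)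
      ultimately show "(- (p / (s * c))) ^ l * (W (j - l) / (s * c)) =
          (- 1 / s) ^ l / (N * s) * (\<rho> i ^ Suc l * U (j - l) + \<rho> i ^ l * V (j - l))"
        by (simp add: algebra_simps add_divide_distrib)
    qed
    finally show ?thesis by (simp add: H_def)
  qed
  have "(\<Sum>i\<in>J. of_nat (m i) * ((TD a ^^ j) (h i) k x / fact j)) =
      (\<Sum>l\<le>j. (- 1 / s) ^ l / (N * s) * ((\<Sum>i\<in>J. of_nat (m i) * \<rho> i ^ Suc l) * U (j - l) +
         (\<Sum>i\<in>J. of_nat (m i) * \<rho> i ^ l) * V (j - l)))"
    by (simp add: H sum_distrib_left sum_distrib_right sum.distrib [symmetric] algebra_simps
        sum.swap [of _ J] cong: sum.cong)
  also have "\<dots> = 0"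
  proof (intro sum.neutral ballI)
    fix l assume "l \<in> {..j}"
    then have l: "l \<le> j" by simp
    show "(- 1 / s) ^ l / (N * s) * ((\<Sum>i\<in>J. of_nat (m i) * \<rho> i ^ Suc l) * U (j - l) +
         (\<Sum>i\<in>J. of_nat (m i) * \<rho> i ^ l) * V (j - l)) = 0"
    proof (cases "even l")
      case True
      \<comment> \<open>Strictness matters: the power \<open>Suc l\<close> is then at most
        \<open>j\<close>, inside the range covered by \<open>cot\<close>.\<close>
      with l j have "l < j" by (metis le_neq_implies_less)
      then have "(\<Sum>i\<in>J. of_nat (m i) * \<rho> i ^ Suc l) = 0"
        unfolding \<rho>_def using True j by (intro cot) auto
      moreover have "V (j - l) = 0"
        using True l j by (intro V0) auto
      ultimately show ?thesis by simp
    next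
      case False
      then have "(\<Sum>i\<in>J. of_nat (m i) * \<rho> i ^ l) = 0"
        unfolding \<rho>_def using l j by (intro cot) auto
      moreover have "U (j - l) = 0"
        using False l j by (intro U0) (auto elim: oddE)
      ultimately show ?thesis by simp
    qed
  qed
  finally show ?thesis
    by (simp add: sum_divide_distrib [symmetric] x_def)
qed

text \<open>On the line, the second normal derivative contributes \<open>Suc j\<close> and the
  singular term of index \<open>a\<close> contributes \<open>- 2 * m a\<close> times the same
  derivative of \<open>h a\<close>; tangential and off-diagonal terms vanish. If
  \<open>j + 2 < 2 * m a\<close>, that derivative of \<open>h a\<close> is 0 by quasi-invariance of
  \<open>f\<close>; otherwise \<open>Suc j = 2 * m a\<close> and the coefficients cancel.\<close>

lemma quasi_inv_BA_step:
  assumes "finite I" "a \<in> I" and nz: "bil (\<alpha> a) (\<alpha> a) \<noteq> 0"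
    and nzi: "\<And>i. i \<in> I - {a} \<Longrightarrow> bil (\<alpha> i) (perp (\<alpha> a)) \<noteq> 0"
    and cot: "\<And>l. odd l \<Longrightarrow> l < 2 * m a \<Longrightarrow>
      (\<Sum>i\<in>I - {a}. of_nat (m i) * (bil (\<alpha> i) (\<alpha> a) / bil (\<alpha> i) (perp (\<alpha> a))) ^ l) = 0"
    and f: "pol f" "quasi_inv (\<alpha> a) (m a) f"
    and h: "\<And>i. i \<in> I \<Longrightarrow> pol (h i)"
      "\<And>i. i \<in> I \<Longrightarrow> TD (\<alpha> i) f = (\<lambda>k x. bil (\<alpha> i) x * h i k x)"
  shows "quasi_inv (\<alpha> a) (m a) (BA_step I m h f)"
  unfolding quasi_inv_def
proof (intro allI impI)
  fix j k x assume j: "odd j" "j < 2 * m a" and x: "bil (\<alpha> a) x = 0"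
  let ?a = "\<alpha> a"
  let ?b = "perp ?a"
  let ?N = "bil ?a ?a"
  let ?D = "TD ?a"
  have a0: "?a \<noteq> 0" using nz by (auto simp: bil_def)
  have pol: "pol (BA_step I m h f)"
    unfolding BA_step_def by (intro pol_intros pol_PD pol_KD f h) auto
  have "(?D ^^ j) (BA_step I m h f) k (s *s ?b) = 0" if s: "s \<noteq> 0" for s
  proof -
    let ?x = "s *s ?b"
    have ax: "bil ?a ?x = 0" by (simp add: bil_def)
    \<comment> \<open>Adding and subtracting \<open>bil k k * f k x\<close> completes the conjugated
      Laplacian, which then splits into normal and tangential squares.\<close>
    have eq: "BA_step I m h f = (\<lambda>k x. ((1 / ?N) * ?D (?D f) k x + (1 / ?N) * TD ?b (TD ?b f) k x) -
        bil k k * f k x - (\<Sum>i\<in>I. (2 * of_nat (m i)) * h i k x))" (is "_ = ?rhs")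
    proof (intro ext)
      fix k x
      have "PD 1 (PD 1 f) k x + PD 2 (PD 2 f) k x + 2 * KD f k x + bil k k * f k x =
          (1 / ?N) * ?D (?D f) k x + (1 / ?N) * TD ?b (TD ?b f) k x"
        using lap_decomp [OF f(1), of ?a k x] nz by (simp add: field_simps)
      then show "BA_step I m h f k x = ?rhs k x"
        by (simp add: BA_step_def sum_distrib_left algebra_simps)
    qed
    have polk: "pol (\<lambda>k x. bil k k * g k x)" if "pol g" for g
      unfolding bil_def by (intro pol_intros pol_k that)
    have "(?D ^^ j) (BA_step I m h f) k ?x =
        (1 / ?N) * (?D ^^ (j + 2)) f k ?x + (1 / ?N) * TD ?b (TD ?b ((?D ^^ j) f)) k ?x -
        bil k k * (?D ^^ j) f k ?x - (\<Sum>i\<in>I. (2 * of_nat (m i)) * (?D ^^ j) (h i) k ?x)"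
      unfolding eq
      by (simp add: TD_funpow_add TD_funpow_diff TD_funpow_scale TD_funpow_sum TD_funpow_commute
          pol_TD pspan_add pspan_scale pspan_diff pspan_sum polk f h
          del: times_divide_eq_left mult_1)
    moreover have "(?D ^^ j) f k ?x = 0"
      using f(2) j ax by (auto simp: quasi_inv_def)
    moreover have "TD ?b (TD ?b ((?D ^^ j) f)) k ?x = 0"
      using f j a0 ax
      by (intro TD_tangential [of _ ?a] pol_TD pol_TD_funpow) (auto simp: quasi_inv_def)
    moreover have "(\<Sum>i\<in>I. (2 * of_nat (m i)) * (?D ^^ j) (h i) k ?x) =
        2 * of_nat (m a) * (?D ^^ j) (h a) k ?x"
    proof -
      have "(\<Sum>i\<in>I - {a}. of_nat (m i) * (?D ^^ j) (h i) k ?x) = 0"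
        by (rule off_diagonal_terms [OF nz nzi cot f h j s]) auto
      then show ?thesis
        using assms(1,2) by (simp add: sum.remove mult.assoc sum_distrib_left [symmetric])
    qed
    moreover have "(?D ^^ (j + 2)) f k ?x = of_nat (Suc j) * ?N * (?D ^^ j) (h a) k ?x"
    proof -
      have "(?D ^^ (j + 2)) f k ?x = (?D ^^ Suc j) (\<lambda>k x. bil ?a x * h a k x) k ?x"
        unfolding h(2) [OF assms(2), symmetric] by (simp add: funpow_swap1)
      also have "\<dots> = of_nat (Suc j) * ?N * (?D ^^ j) (h a) k ?x"
        by (subst TD_lin_funpow [OF h(1) [OF assms(2)]]) (simp_all add: ax)
      finally show ?thesis .
    qed
    ultimately have "(?D ^^ j) (BA_step I m h f) k ?x =
        1 / ?N * (of_nat (Suc j) * ?N * (?D ^^ j) (h a) k ?x) - 2 * of_nat (m a) * (?D ^^ j) (h a) k ?x"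
      by (simp only: mult_zero_right diff_zero add_0_right)
    also have "\<dots> = (of_nat (Suc j) - of_nat (2 * m a)) * (?D ^^ j) (h a) k ?x"
      using nz by (simp add: left_diff_distrib del: of_nat_Suc)
    finally have eq2: "(?D ^^ j) (BA_step I m h f) k ?x =
        (of_nat (Suc j) - of_nat (2 * m a)) * (?D ^^ j) (h a) k ?x" .
    show ?thesis
    proof (cases "j + 2 < 2 * m a")
      case True
      then have "(?D ^^ (j + 2)) f k ?x = 0"
        using f(2) j ax by (auto simp: quasi_inv_def simp del: funpow.simps)
      then have "(?D ^^ j) (h a) k ?x = 0"
        using \<open>(?D ^^ (j + 2)) f k ?x = of_nat (Suc j) * ?N * (?D ^^ j) (h a) k ?x\<close> nz
        by (simp del: of_nat_Suc)
      then show ?thesis using eq2 by simp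
    next
      case False
      with j have "Suc j = 2 * m a" by presburger
      then show ?thesis unfolding eq2 by (simp del: of_nat_Suc)
    qed
  qed
  then have "(?D ^^ j) (BA_step I m h f) k ((bil ?b x / ?N) *s ?b) = 0"
    by (rule pol_vanish_zero [OF pol_TD_funpow [OF pol]])
  then show "(?D ^^ j) (BA_step I m h f) k x = 0"
    using on_hyperplane [OF x nz] by simp
qed

section \<open>Existence of the Baker-Akhiezer function\<close>

lemma TD_power_lin:
  assumes "pol g"
  shows "\<exists>g'. pol g' \<and> TD v (\<lambda>k x. bil a x ^ Suc r * g k x) = (\<lambda>k x. bil a x ^ r * g' k x)"
proof (induction r)
  case 0
  have "pol (\<lambda>k x. bil a x * TD v g k x + bil a v * g k x)"
    by (intro pol_intros pol_TD assms)
  then show ?case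
    using DD_lin [OF assms, of "\<lambda>k. v" "bil v" a]
    by (intro exI [of _ "\<lambda>k x. bil a x * TD v g k x + bil a v * g k x"]) simp
next
  case (Suc r)
  then obtain g' where g': "pol g'"
    "TD v (\<lambda>k x. bil a x ^ Suc r * g k x) = (\<lambda>k x. bil a x ^ r * g' k x)" by blast
  have p: "pol (\<lambda>k x. bil a x ^ Suc r * g k x)"
    by (intro pol_intros assms)
  have "TD v (\<lambda>k x. bil a x ^ Suc (Suc r) * g k x) = TD v (\<lambda>k x. bil a x * (bil a x ^ Suc r * g k x))"
    by (simp only: power_Suc mult.assoc)
  also have "\<dots> = (\<lambda>k x. bil a x ^ Suc r * (g' k x + bil a v * g k x))"
    unfolding DD_lin [OF p] g'(2) by (simp add: algebra_simps)
  finally show ?case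
    using pspan_add [OF pspan_scale [OF assms] g'(1)] by blast
qed

lemma TD_funpow_power_lin:
  assumes "pol g" "j \<le> n"
  shows "\<exists>g'. pol g' \<and> (TD v ^^ j) (\<lambda>k x. bil a x ^ n * g k x) = (\<lambda>k x. bil a x ^ (n - j) * g' k x)"
  using assms(2)
proof (induction j)
  case 0
  then show ?case using assms(1) by auto
next
  case (Suc j)
  then obtain g' where g': "pol g'"
    "(TD v ^^ j) (\<lambda>k x. bil a x ^ n * g k x) = (\<lambda>k x. bil a x ^ Suc (n - Suc j) * g' k x)"
    by (auto simp: Suc_diff_Suc simp del: power_Suc)
  show ?case
    unfolding funpow.simps o_apply g'(2) by (rule TD_power_lin [OF g'(1)])
qed

text \<open>Each derivative lowers the order of vanishing by at most one, so all derivatives of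
  order below \<open>2 * n\<close>, even or odd, vanish on the line.\<close>

lemma quasi_inv_power_lin:
  assumes "pol g"
  shows "quasi_inv a n (\<lambda>k x. bil a x ^ (2 * n) * g k x)"
  unfolding quasi_inv_def
proof (intro allI impI)
  fix j k x assume "odd j" "j < 2 * n" "bil a x = 0"
  then show "(TD a ^^ j) (\<lambda>k x. bil a x ^ (2 * n) * g k x) k x = 0"
    using TD_funpow_power_lin [OF assms, of j "2 * n" a a] by auto
qed

text \<open>Links \<open>TD\<close> to the actual derivative: differentiating the exponential
  produces the zeroth-order term of \<open>TD\<close>.\<close>

lemma dir_deriv_exp:
  assumes "pol f"
  shows "dir_deriv a (\<lambda>x. f k x * exp (bil k x)) = (\<lambda>x. TD a f k x * exp (bil k x))"
proof
  fix x
  have "partial_deriv i (\<lambda>x. f k x * exp (bil k x)) x = (PD i f k x + k $ i * f k x) * exp (bil k x)" for i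
  proof -
    have "((\<lambda>z. f k (upd i z x)) has_field_derivative PD i f k x) (at (x $ i))"
      unfolding PD_eq DERIV_deriv_iff_field_differentiable by (rule pol_differentiable [OF assms])
    moreover have "((\<lambda>z. bil k (upd i z x)) has_field_derivative k $ i) (at (x $ i))"
      using exhaust_2 [of i] by (auto simp: bil_def upd_def intro!: derivative_eq_intros)
    ultimately have "((\<lambda>z. f k (upd i z x) * exp (bil k (upd i z x))) has_field_derivative
        (PD i f k x + k $ i * f k x) * exp (bil k x)) (at (x $ i))"
      by (auto intro!: derivative_eq_intros simp: algebra_simps)
    then show ?thesis
      by (simp add: partial_deriv_def upd_def DERIV_imp_deriv)
  qed
  then show "dir_deriv a (\<lambda>x. f k x * exp (bil k x)) x = TD a f k x * exp (bil k x)"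
    by (simp add: dir_deriv_def DD_def bil_def algebra_simps)
qed

lemma dir_deriv_funpow_exp:
  "pol f \<Longrightarrow> (dir_deriv a ^^ j) (\<lambda>x. f k x * exp (bil k x)) = (\<lambda>x. (TD a ^^ j) f k x * exp (bil k x))"
  by (induction j) (simp_all add: dir_deriv_exp pol_TD_funpow)

lemma quasi_inv_imp_dir_deriv:
  assumes "pol f" "quasi_inv a n f" "s \<in> {1..n}" "bil a x = 0"
  shows "(dir_deriv a ^^ (2 * s - 1)) (\<lambda>x. f k x * exp (bil k x)) x = 0"
proof -
  have "odd (2 * s - 1)" "2 * s - 1 < 2 * n" using assms(3) by auto
  then show ?thesis
    using assms by (simp add: dir_deriv_funpow_exp quasi_inv_def)
qed

lemma quasi_inv_scale:
  assumes "pol f" "quasi_inv a n f"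
  shows "quasi_inv a n (\<lambda>k x. c * f k x)"
  using assms by (simp add: quasi_inv_def TD_funpow_scale)

text \<open>The derivative lowers the total degree by one and the factor from \<open>k\<close>
  restores it. The case \<open>d = 0\<close> is separate because only the zero function has degree
  below 0.\<close>

lemma KD_pless:
  assumes "pless d f"
  shows "pless d (KD f)"
proof (cases d)
  case 0
  have "f = (\<lambda>k x. 0)"
    using pspan_coeffs [OF assms] 0 by (auto simp: fun_eq_iff)
  then show ?thesis by (simp add: DD_const pspan.zero)
next
  case (Suc d')
  have "pless (1 + d') (\<lambda>k x. k $ i * PD j f k x)" for i j
    unfolding bil_axis [of _ i]
    by (rule pless_mult [OF phom_pless [OF phom_bil_k] PD_pless]) (use assms Suc in auto)
  from pspan_add [OF this this, of 1 1 2 2] show ?thesis by (simp add: DD_def Suc)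
qed

lemma KD_funpow_pless: "pless d f \<Longrightarrow> pless d ((KD ^^ n) f)"
  by (induction n) (auto intro: KD_pless)

lemma baker_akhiezer_exists:
  fixes \<alpha> :: "'i \<Rightarrow> complex ^ 2" and m :: "'i \<Rightarrow> nat"
  assumes fin: "finite I" and m: "\<And>i. i \<in> I \<Longrightarrow> m i > 0"
    and nz: "\<And>i. i \<in> I \<Longrightarrow> bil (\<alpha> i) (\<alpha> i) \<noteq> 0"
    and nzi: "\<And>a i. a \<in> I \<Longrightarrow> i \<in> I - {a} \<Longrightarrow> bil (\<alpha> i) (perp (\<alpha> a)) \<noteq> 0"
    and cot: "\<And>a l. a \<in> I \<Longrightarrow> odd l \<Longrightarrow> l < 2 * m a \<Longrightarrow>
      (\<Sum>i\<in>I - {a}. of_nat (m i) * (bil (\<alpha> i) (\<alpha> a) / bil (\<alpha> i) (perp (\<alpha> a))) ^ l) = 0"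
  shows "\<exists>\<phi>. baker_akhiezer I \<alpha> m \<phi>"
proof -
  define A :: fn where "A = (\<lambda>k x. \<Prod>i\<in>I. bil (\<alpha> i) x ^ m i)"
  \<comment> \<open>\<open>A' i\<close> is \<open>A\<close> with one factor
    \<open>bil (\<alpha> i) x\<close> removed; positivity of \<open>m i\<close> makes the truncated
    exponent correct.\<close>
  define A' :: "'i \<Rightarrow> fn" where
    "A' = (\<lambda>i k x. bil (\<alpha> i) x ^ (m i - 1) * (\<Prod>j\<in>I - {i}. bil (\<alpha> j) x ^ m j))"
  define M where "M = (\<Sum>i\<in>I. m i)"
  have \<alpha>0: "\<alpha> i \<noteq> 0" if "i \<in> I" for i
    using nz [OF that] by (auto simp: bil_def)
  have hom_bil_x: "phom M (\<lambda>k x. \<Prod>i\<in>I. bil (\<alpha> i) x ^ m i)"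
    unfolding M_def using phom_power [OF phom_bil_x] by (intro phom_prod) simp
  have hom_bil_k: "phom M (\<lambda>k x. \<Prod>i\<in>I. bil (\<alpha> i) k ^ m i)"
    unfolding M_def using phom_power [OF phom_bil_k] by (intro phom_prod) simp
  have A: "phom M A"
    unfolding A_def by (rule hom_bil_x)
  then have polA: "pol A" and lessA: "pless (Suc M) A"
    by (auto intro: pspan_imp_pol phom_pless)
  have polA': "pol (A' i)" for i
    unfolding A'_def by (intro pol_intros)
  have AA': "A k x = bil (\<alpha> i) x * A' i k x" if "i \<in> I" for i k x
  proof -
    have "bil (\<alpha> i) x ^ m i = bil (\<alpha> i) x * bil (\<alpha> i) x ^ (m i - 1)"
      using m [OF that] by (cases "m i") simp_all
    then show ?thesis
      unfolding A_def A'_def prod.remove [OF fin that] by (simp only: mult.assoc)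
  qed
  have KDA: "KD A = (\<lambda>k x. \<Sum>i\<in>I. of_nat (m i) * (bil (\<alpha> i) k * A' i k x))"
    unfolding A_def A'_def by (rule KD_prod [OF fin])
  \<comment> \<open>The invariant of the iteration: the leading part is explicit and everything of
    total degree below \<open>2 * M\<close> is left in \<open>R\<close>.\<close>
  have step: "\<exists>R f. pol f \<and> pless (2 * M) R \<and>
      f = (\<lambda>k x. A k x * (2 ^ n * (KD ^^ n) A k x) + R k x) \<and>
      (\<forall>i\<in>I. quasi_inv (\<alpha> i) (m i) f)" for n
  proof (induction n)
    case 0
    have "quasi_inv (\<alpha> i) (m i) (\<lambda>k x. A k x * A k x)" if "i \<in> I" for i
    proof -
      define B :: fn where "B = (\<lambda>k x. \<Prod>j\<in>I - {i}. bil (\<alpha> j) x ^ m j)"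
      have "A k x * A k x = bil (\<alpha> i) x ^ (2 * m i) * B k x ^ 2" for k x
      proof -
        have "A k x = bil (\<alpha> i) x ^ m i * B k x"
          unfolding A_def B_def by (rule prod.remove [OF fin that])
        then show ?thesis
          unfolding power2_eq_square mult_2 power_add by (simp only: ac_simps)
      qed
      then have eq: "(\<lambda>k x. A k x * A k x) = (\<lambda>k x. bil (\<alpha> i) x ^ (2 * m i) * B k x ^ 2)"
        by (intro ext)
      show ?thesis
        unfolding eq B_def by (intro quasi_inv_power_lin pol_intros)
    qed
    then show ?case
      using pspan.zero pol_mult [OF polA polA]
      by - (rule exI [of _ "\<lambda>k x. 0"], rule exI [of _ "\<lambda>k x. A k x * A k x"], simp)
  next
    case (Suc n)
    define S :: fn where "S = (\<lambda>k x. 2 ^ n * (KD ^^ n) A k x)"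
    have polS: "pol S" and lessS: "pless (Suc M) S"
      unfolding S_def by (intro pspan_scale pol_KD_funpow polA KD_funpow_pless lessA)+
    obtain R f where R: "pless (2 * M) R" and f: "pol f" "f = (\<lambda>k x. A k x * S k x + R k x)"
      "\<And>i. i \<in> I \<Longrightarrow> quasi_inv (\<alpha> i) (m i) f"
      using Suc.IH unfolding S_def by blast
    have lessf: "pless (Suc (2 * M)) f"
      unfolding f(2)
    proof (rule pspan_add)
      show "pless (Suc (2 * M)) (\<lambda>k x. A k x * S k x)"
        using pless_mult [OF lessA lessS] by (simp add: mult_2)
    qed (use pless_mono [OF R] in simp)
    \<comment> \<open>The leading part of \<open>TD (\<alpha> i) f\<close> is divisible through
      \<open>A\<close>. What remains vanishes on the line by the condition of order 1, hence is
      divisible too; its quotient has degree below \<open>2 * M\<close> and so only affects the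
      remainder.\<close>
    have "\<exists>g. pless (2 * M) g \<and> (\<lambda>k x. TD (\<alpha> i) f k x - bil (\<alpha> i) k * (A k x * S k x)) =
        (\<lambda>k x. bil (\<alpha> i) x * g k x)" if i: "i \<in> I" for i
    proof (rule pless_divide [OF _ \<alpha>0 [OF i]])
      have "pless (1 + 2 * M) (\<lambda>k x. bil (\<alpha> i) k * R k x)"
        by (rule pless_mult [OF phom_pless [OF phom_bil_k] R]) simp
      moreover have "pless (Suc (2 * M)) (\<lambda>k x. c * PD j f k x)" for c j
        by (rule pspan_scale [OF pless_mono [OF PD_pless [OF lessf]]]) simp
      ultimately have "pless (Suc (2 * M)) (\<lambda>k x. \<alpha> i $ 1 * PD 1 f k x + \<alpha> i $ 2 * PD 2 f k x +
          bil (\<alpha> i) k * R k x)"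
        by (intro pspan_add) simp_all
      also have "(\<lambda>k x. \<alpha> i $ 1 * PD 1 f k x + \<alpha> i $ 2 * PD 2 f k x + bil (\<alpha> i) k * R k x) =
          (\<lambda>k x. TD (\<alpha> i) f k x - bil (\<alpha> i) k * (A k x * S k x))"
      proof -
        have "bil (\<alpha> i) k * f k x = bil (\<alpha> i) k * (A k x * S k x) + bil (\<alpha> i) k * R k x" for k x
          by (subst f(2)) (simp add: algebra_simps)
        then show ?thesis by (simp add: DD_def add.assoc)
      qed
      finally show "pless (Suc (2 * M)) (\<lambda>k x. TD (\<alpha> i) f k x - bil (\<alpha> i) k * (A k x * S k x))" .
      fix k x assume x: "bil (\<alpha> i) x = 0"
      have "(TD (\<alpha> i) ^^ 1) f k x = 0"
        using f(3) [OF i, unfolded quasi_inv_def, rule_format, of 1 x k] m [OF i] x by simp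
      then show "TD (\<alpha> i) f k x - bil (\<alpha> i) k * (A k x * S k x) = 0"
        using AA' [OF i] x by simp
    qed
    then have "\<forall>i\<in>I. \<exists>g. pless (2 * M) g \<and>
        (\<lambda>k x. TD (\<alpha> i) f k x - bil (\<alpha> i) k * (A k x * S k x)) = (\<lambda>k x. bil (\<alpha> i) x * g k x)"
      by blast
    from bchoice [OF this] obtain g where g: "\<And>i. i \<in> I \<Longrightarrow> pless (2 * M) (g i)"
      "\<And>i. i \<in> I \<Longrightarrow> (\<lambda>k x. TD (\<alpha> i) f k x - bil (\<alpha> i) k * (A k x * S k x)) =
        (\<lambda>k x. bil (\<alpha> i) x * g i k x)"
      by blast
    define h :: "'i \<Rightarrow> fn" where "h = (\<lambda>i k x. bil (\<alpha> i) k * (A' i k x * S k x) + g i k x)"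
    have polh: "pol (h i)" if "i \<in> I" for i
      unfolding h_def by (intro pol_intros polA' polS pspan_imp_pol [OF g(1) [OF that]])
    have h: "TD (\<alpha> i) f = (\<lambda>k x. bil (\<alpha> i) x * h i k x)" if i: "i \<in> I" for i
    proof (intro ext)
      fix k x
      show "TD (\<alpha> i) f k x = bil (\<alpha> i) x * h i k x"
        using fun_cong [OF fun_cong [OF g(2) [OF i]], of k x] AA' [OF i, of k x]
        by (simp add: h_def algebra_simps)
    qed
    define R' :: fn where "R' = (\<lambda>k x. PD 1 (PD 1 f) k x + PD 2 (PD 2 f) k x + 2 * KD R k x -
      2 * (\<Sum>i\<in>I. of_nat (m i) * g i k x))"
    have "pless (2 * M) (PD i (PD i f))" for i
      by (rule PD_pless [OF pless_mono [OF PD_pless [OF lessf]]]) simp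
    then have "pless (2 * M) R'"
      unfolding R'_def by (intro pspan_diff pspan_add pspan_scale pspan_sum KD_pless [OF R] g)
    \<comment> \<open>Twice \<open>KD\<close> of \<open>A * S\<close> gives
      \<open>2 * A * KD S\<close> and \<open>2 * KD A * S\<close>. The leading parts of the
      \<open>h i\<close> sum to \<open>KD A * S\<close>, so the second term cancels.\<close>
    moreover have "BA_step I m h f = (\<lambda>k x. A k x * (2 ^ Suc n * (KD ^^ Suc n) A k x) + R' k x)"
    proof (intro ext)
      fix k x
      have "KD f k x = A k x * KD S k x + KD A k x * S k x + KD R k x"
        unfolding f(2) using polA polS R
        by (simp add: DD_add KD_mult pol_mult pspan_imp_pol [OF R])
      moreover have "(\<Sum>i\<in>I. of_nat (m i) * h i k x) =
          KD A k x * S k x + (\<Sum>i\<in>I. of_nat (m i) * g i k x)"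
        by (simp add: h_def KDA sum.distrib sum_distrib_right distrib_left mult.assoc)
      moreover have "KD S k x = 2 ^ n * (KD ^^ Suc n) A k x"
        unfolding S_def by (simp add: DD_scale pol_KD_funpow polA)
      ultimately show "BA_step I m h f k x = A k x * (2 ^ Suc n * (KD ^^ Suc n) A k x) + R' k x"
        unfolding BA_step_def R'_def by (simp add: algebra_simps)
    qed
    moreover have "pol (BA_step I m h f)"
      unfolding BA_step_def by (intro pol_intros pol_PD pol_KD f(1) polh)
    moreover have "quasi_inv (\<alpha> i) (m i) (BA_step I m h f)" if i: "i \<in> I" for i
      by (rule quasi_inv_BA_step [OF fin i nz nzi cot f(1) f(3) polh h]) (use i in auto)
    ultimately show ?case by blast
  qed
  \<comment> \<open>Each of the \<open>M\<close> steps gives a factor 2, and \<open>M\<close>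
    derivatives turn \<open>A\<close> at \<open>x\<close> into \<open>fact M\<close> times its value
    at \<open>k\<close>; dividing by \<open>c\<close> normalizes the highest term.\<close>
  define c :: complex where "c = 2 ^ M * fact M"
  have c: "c \<noteq> 0" by (simp add: c_def)
  define T :: fn where "T = (\<lambda>k x. \<Prod>i\<in>I. bil (\<alpha> i) k ^ m i * bil (\<alpha> i) x ^ m i)"
  have AT: "A k x * (2 ^ M * (KD ^^ M) A k x) = c * T k x" for k x
  proof -
    have "(KD ^^ M) A k x = fact M * (\<Prod>i\<in>I. bil (\<alpha> i) k ^ m i)"
      unfolding A_def M_def by (rule fun_cong [OF fun_cong [OF KD_funpow_prod [OF fin]]])
    then show ?thesis
      unfolding T_def c_def prod.distrib by (simp only: A_def ac_simps)
  qed
  obtain R f where R: "pless (2 * M) R" and f: "pol f" "f = (\<lambda>k x. c * T k x + R k x)"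
    "\<And>i. i \<in> I \<Longrightarrow> quasi_inv (\<alpha> i) (m i) f"
    using step [of M] unfolding AT by blast
  define P :: fn where "P = (\<lambda>k x. (1 / c) * f k x)"
  have polP: "pol P"
    unfolding P_def by (intro pol_intros f)
  have "highest_term P T"
    unfolding highest_term_def
  proof (rule exI [of _ "M + M"], intro conjI)
    have "phom (M + M) T"
      unfolding T_def prod.distrib by (rule phom_mult [OF hom_bil_k hom_bil_x])
    from pspan_coeffs [OF this finite_tdeg_eq] show "homogeneous_poly (M + M) T"
      unfolding homogeneous_poly_def .
    have "pless (M + M) (\<lambda>k x. (1 / c) * R k x)"
      using R unfolding mult_2 by (rule pspan_scale)
    moreover have "P k x - T k x = (1 / c) * R k x" for k x
      unfolding P_def f(2) using c by (simp add: field_simps)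
    ultimately have "pless (M + M) (\<lambda>k x. P k x - T k x)"
      by simp
    from pspan_coeffs [OF this finite_tdeg_less]
    show "poly_deg_less (M + M) (\<lambda>k x. P k x - T k x)"
      unfolding poly_deg_less_def .
    \<comment> \<open>The vector with coordinates 1 and \<open>z\<close> avoids all the lines once
      \<open>z\<close> avoids finitely many slopes. If \<open>\<alpha> i $ 2 = 0\<close>,
      non-isotropy makes the first coordinate nonzero.\<close>
    obtain z where z: "z \<notin> (\<lambda>i. - \<alpha> i $ 1 / \<alpha> i $ 2) ` I"
      using ex_new_if_finite [OF infinite_UNIV_char_0 finite_imageI [OF fin]] by blast
    have "bil (\<alpha> i) (vector [1, z]) \<noteq> 0" if "i \<in> I" for i
    proof (cases "\<alpha> i $ 2 = 0")
      case True
      then show ?thesis using nz [OF that] by (auto simp: bil_def)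
    next
      case False
      have "bil (\<alpha> i) (vector [1, z]) = \<alpha> i $ 2 * (z - - \<alpha> i $ 1 / \<alpha> i $ 2)"
        using False by (simp add: bil_def field_simps)
      moreover have "z \<noteq> - \<alpha> i $ 1 / \<alpha> i $ 2" using z that by blast
      ultimately show ?thesis
        using False by (simp only: mult_eq_0_iff right_minus_eq) simp
    qed
    then have "T (vector [1, z]) (vector [1, z]) \<noteq> 0"
      using fin by (simp add: T_def)
    then show "\<exists>k x. T k x \<noteq> 0" by blast
  qed
  moreover have "quasi_inv (\<alpha> i) (m i) P" if "i \<in> I" for i
    unfolding P_def by (rule quasi_inv_scale [OF f(1) f(3) [OF that]])
  ultimately have "baker_akhiezer I \<alpha> m (\<lambda>k x. P k x * exp (bil k x))"
    unfolding baker_akhiezer_def T_def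
    by (intro conjI exI [of _ P] ballI allI impI quasi_inv_imp_dir_deriv [OF polP]) auto
  then show ?thesis by blast
qed

section \<open>The symmetric configuration\<close>

lemma perp_imp_proportional:
  assumes "bil a a \<noteq> 0" "bil v (perp a) = 0"
  shows "proportional v a"
proof -
  have "bil a a * v $ 1 = bil v a * a $ 1 - bil v (perp a) * a $ 2"
    "bil a a * v $ 2 = bil v a * a $ 2 + bil v (perp a) * a $ 1"
    by (simp_all add: bil_def algebra_simps)
  with assms have "v = (bil v a / bil a a) *s a"
    by (simp add: vec_eq_iff forall_2 field_simps)
  then show ?thesis unfolding proportional_def by blast
qed

text \<open>The map \<open>\<sigma>\<close> permutes the indices other than \<open>a\<close> and
  negates each ratio \<open>q i / d i\<close>, so the odd power sum equals its own negative. The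
  cross-multiplied hypotheses also make sense at \<open>a\<close>, where
  \<open>d a = 0\<close>.\<close>

lemma odd_sum_eq_0:
  fixes q d :: "'i \<Rightarrow> complex" and m :: "'i \<Rightarrow> nat"
  assumes "finite I" "a \<in> I" and \<sigma>: "\<And>i. i \<in> I \<Longrightarrow> \<sigma> i \<in> I" "\<And>i. i \<in> I \<Longrightarrow> m (\<sigma> i) = m i"
    and refl: "\<And>i. i \<in> I \<Longrightarrow> q (\<sigma> i) * d i + d (\<sigma> i) * q i = 0"
    and d: "\<And>i. i \<in> I - {a} \<Longrightarrow> d i \<noteq> 0" and q: "q a \<noteq> 0" and da: "d a = 0"
    and inj: "\<And>i j. i \<in> I \<Longrightarrow> j \<in> I \<Longrightarrow> q i * d j = q j * d i \<Longrightarrow> i = j"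
    and "odd l"
  shows "(\<Sum>i\<in>I - {a}. of_nat (m i) * (q i / d i) ^ l) = 0"
proof -
  let ?f = "\<lambda>i. of_nat (m i) * (q i / d i) ^ l"
  have \<sigma>a: "\<sigma> i \<in> I - {a}" if i: "i \<in> I - {a}" for i
  proof -
    have "\<sigma> i \<noteq> a"
    proof
      assume "\<sigma> i = a"
      then show False using refl [of i] d [OF i] q da i by simp
    qed
    with \<sigma> i show ?thesis by auto
  qed
  have ratio: "q (\<sigma> i) / d (\<sigma> i) = - (q i / d i)" if i: "i \<in> I - {a}" for i
    using refl [of i] d [OF i] d [OF \<sigma>a [OF i]] i by (simp add: field_simps eq_neg_iff_add_eq_0)
  have "inj_on \<sigma> (I - {a})"
  proof (rule inj_onI)
    fix i j assume ij: "i \<in> I - {a}" "j \<in> I - {a}" "\<sigma> i = \<sigma> j"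
    then have "q i / d i = q j / d j"
      using ratio [of i] ratio [of j] by simp
    then show "i = j"
      using d [of i] d [of j] ij by (intro inj) (auto simp: field_simps)
  qed
  moreover from this have "\<sigma> ` (I - {a}) = I - {a}"
    using \<sigma>a assms(1) by (intro endo_inj_surj) auto
  ultimately have "bij_betw \<sigma> (I - {a}) (I - {a})"
    by (rule bij_betw_imageI)
  then have "sum ?f (I - {a}) = (\<Sum>i\<in>I - {a}. ?f (\<sigma> i))"
    by (rule sum.reindex_bij_betw [symmetric])
  also have "\<dots> = - sum ?f (I - {a})"
    unfolding sum_negf [symmetric] using \<sigma>(2) ratio \<open>odd l\<close> by (intro sum.cong) auto
  finally show ?thesis by simp
qed

section \<open>Real lines, reflections and cotangents\<close>

lemma bil_complexify: "bil (complexify u) (complexify v) = of_real (u \<bullet> v)"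
  by (simp add: bil_def complexify_def inner_vec_def sum_2)

lemma bil_perp_complexify:
  "bil (complexify u) (perp (complexify v)) = of_real (u $ 2 * v $ 1 - u $ 1 * v $ 2)"
  by (simp add: bil_def complexify_def)

text \<open>The reflected spanning vector \<open>v\<close> of the first line must be orthogonal to
  \<open>w\<close>. Cross-multiplied, the result says that \<open>u\<close> and \<open>w\<close>
  have opposite cotangents relative to \<open>a\<close>.\<close>

lemma reflection_orth_line:
  assumes a: "a \<bullet> a \<noteq> 0" and "reflection a ` orth_line u = orth_line w"
  shows "(w \<bullet> a) * (u $ 2 * a $ 1 - u $ 1 * a $ 2) + (w $ 2 * a $ 1 - w $ 1 * a $ 2) * (u \<bullet> a) = 0"
proof -
  define v :: "real ^ 2" where "v = vector [- (u $ 2), u $ 1]"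
  have "v \<in> orth_line u"
    by (simp add: orth_line_def v_def inner_vec_def sum_2)
  then have "w \<bullet> reflection a v = 0"
    using assms(2) by (auto simp: orth_line_def)
  then have "(a \<bullet> a) * (w \<bullet> v) - 2 * (a \<bullet> v) * (w \<bullet> a) = 0"
    using a by (simp add: reflection_def inner_diff_right field_simps)
  then show ?thesis
    by (simp add: v_def inner_vec_def sum_2 algebra_simps)
qed

text \<open>Factoring out \<open>cis (x + y)\<close> leaves the Euler formulas for cosine and sine.
  When the sine is 0, both sides are 0 by the convention on division.\<close>

lemma cis_quotient:
  "(cis (2 * x) + cis (2 * y)) / (cis (2 * x) - cis (2 * y)) =
    - \<i> * of_real (cos (x - y) / sin (x - y))"
proof -
  define E c s where "E = cis (x + y)" and "c = cos (x - y)" and "s = sin (x - y)"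
  have "sin (y - x) = - s" "cos (y - x) = c"
    using sin_minus [of "x - y"] cos_minus [of "x - y"] by (simp_all add: c_def s_def)
  then have cs: "cis (x - y) + cis (y - x) = 2 * of_real c" "cis (x - y) - cis (y - x) = 2 * \<i> * of_real s"
    by (simp_all add: complex_eq_iff c_def s_def)
  have x: "cis (2 * x) = E * cis (x - y)" and y: "cis (2 * y) = E * cis (y - x)"
    by (simp_all add: cis_mult E_def)
  have "(cis (2 * x) + cis (2 * y)) / (cis (2 * x) - cis (2 * y)) = E * (2 * of_real c) / (E * (2 * \<i> * of_real s))"
    unfolding x y distrib_left [symmetric] right_diff_distrib [symmetric] cs ..
  also have "\<dots> = - \<i> * of_real (c / s)"
    by (cases "s = 0") (simp_all add: E_def field_simps)
  finally show ?thesis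
    unfolding c_def s_def .
qed

theorem theorem3p4:
  fixes m m' n :: nat and \<alpha> :: "nat \<Rightarrow> real ^ 2"
  assumes "m \<ge> 1" and "m' \<ge> 1" and "n > 0" and "even n"
    and "is_config_A m m' n \<alpha>"
  shows "\<exists>\<phi>. baker_akhiezer {0..n+1} (\<lambda>i. complexify (\<alpha> i)) (mult_A m m' n) \<phi>"
proof -
  let ?I = "{0..n+1}"
  define A where "A = (\<lambda>i. complexify (\<alpha> i))"
  let ?m = "mult_A m m' n"
  have conf: "configuration ?I A" and orth: "\<alpha> 0 \<bullet> \<alpha> (n+1) = 0"
    and sym: "\<forall>i\<in>?I. \<exists>j\<in>?I. ?m j = ?m i \<and> reflection (\<alpha> 0) ` orth_line (\<alpha> i) = orth_line (\<alpha> j)"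
    using assms(5) unfolding is_config_A_def A_def by blast+
  obtain \<theta> where \<theta>: "\<forall>s\<in>?I. \<exists>r. r \<noteq> 0 \<and> \<alpha> s = r *\<^sub>R vector [cos (\<theta> s), sin (\<theta> s)]"
    and stieltjes: "\<forall>j\<in>{1..n}. (\<Sum>i\<in>?I - {j}. of_nat (?m i) * (cis (2 * \<theta> i) + cis (2 * \<theta> j)) /
              (cis (2 * \<theta> i) - cis (2 * \<theta> j))) = 0"
    using assms(5) unfolding is_config_A_def by blast
  obtain r where r: "\<And>s. s \<in> ?I \<Longrightarrow> r s \<noteq> 0"
    "\<And>s. s \<in> ?I \<Longrightarrow> \<alpha> s = r s *\<^sub>R vector [cos (\<theta> s), sin (\<theta> s)]"
    using \<theta> by metis
  obtain \<sigma> where \<sigma>: "\<And>i. i \<in> ?I \<Longrightarrow> \<sigma> i \<in> ?I" "\<And>i. i \<in> ?I \<Longrightarrow> ?m (\<sigma> i) = ?m i"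
    "\<And>i. i \<in> ?I \<Longrightarrow> reflection (\<alpha> 0) ` orth_line (\<alpha> i) = orth_line (\<alpha> (\<sigma> i))"
    using sym by metis
  have nz: "bil (A i) (A i) \<noteq> 0" if "i \<in> ?I" for i
    using conf that by (auto simp: configuration_def)
  have nzi: "bil (A i) (perp (A a)) \<noteq> 0" if "a \<in> ?I" "i \<in> ?I - {a}" for a i
    using conf that perp_imp_proportional [OF nz [OF that(1)], of "A i"]
    by (auto simp: configuration_def)
  have refl0: "bil (A (\<sigma> i)) (A 0) * bil (A i) (perp (A 0)) +
      bil (A (\<sigma> i)) (perp (A 0)) * bil (A i) (A 0) = 0" if "i \<in> ?I" for i
  proof -
    have "\<alpha> 0 \<bullet> \<alpha> 0 \<noteq> 0"
      using nz [of 0] by (auto simp: A_def bil_complexify)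
    from reflection_orth_line [OF this \<sigma>(3) [OF that]] show ?thesis
      unfolding A_def bil_complexify bil_perp_complexify
      by (simp only: of_real_mult [symmetric] of_real_add [symmetric] of_real_0)
  qed
  have refl: "bil (A (\<sigma> i)) (A a) * bil (A i) (perp (A a)) +
      bil (A (\<sigma> i)) (perp (A a)) * bil (A i) (A a) = 0" if "i \<in> ?I" and a: "a = 0 \<or> a = n + 1" for i a
    using a
  proof
    \<comment> \<open>The last vector is a multiple of \<open>perp (A 0)\<close>, so passing to it
      inverts the ratios up to sign, and the relation for index 0 carries over with the factor
      \<open>- (t * t)\<close>.\<close>
    assume a: "a = n + 1"
    have "bil (A 0) (A a) = 0"
      using orth by (simp add: A_def bil_complexify a)
    then obtain t where t: "A a = t *s perp (A 0)"
      using on_hyperplane nz [of 0] by auto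
    have "bil v (A a) = t * bil v (perp (A 0))" "bil v (perp (A a)) = - t * bil v (A 0)" for v
      by (simp_all add: bil_def t algebra_simps)
    then have "bil (A (\<sigma> i)) (A a) * bil (A i) (perp (A a)) + bil (A (\<sigma> i)) (perp (A a)) * bil (A i) (A a) =
        - (t * t) * (bil (A (\<sigma> i)) (A 0) * bil (A i) (perp (A 0)) +
          bil (A (\<sigma> i)) (perp (A 0)) * bil (A i) (A 0))"
      by (simp add: algebra_simps)
    then show ?thesis
      by (simp only: refl0 [OF that(1)] mult_zero_right)
  qed (use refl0 that in simp)
  show ?thesis
    unfolding A_def [symmetric]
  proof (rule baker_akhiezer_exists)
    show "?m i > 0" for i
      using assms by (simp add: mult_A_def)
    fix a l assume a: "a \<in> ?I" and l: "odd l" "l < 2 * ?m a"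
    show "(\<Sum>i\<in>?I - {a}. of_nat (?m i) * (bil (A i) (A a) / bil (A i) (perp (A a))) ^ l) = 0"
    proof (cases "a = 0 \<or> a = n + 1")
      case True
      show ?thesis
      proof (rule odd_sum_eq_0 [where \<sigma> = \<sigma>])
        fix i j assume ij: "i \<in> ?I" "j \<in> ?I"
          and eq: "bil (A i) (A a) * bil (A j) (perp (A a)) = bil (A j) (A a) * bil (A i) (perp (A a))"
        \<comment> \<open>Equal ratios relative to \<open>A a\<close> force \<open>A i\<close> and
          \<open>A j\<close> to be proportional, hence the indices to agree.\<close>
        have "bil (A a) (A a) * bil (A i) (perp (A j)) =
            bil (A j) (A a) * bil (A i) (perp (A a)) - bil (A i) (A a) * bil (A j) (perp (A a))"
          by (simp add: bil_def algebra_simps)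
        with eq nz [OF a] have "bil (A i) (perp (A j)) = 0" by simp
        then show "i = j" using nzi ij by auto
      qed (use a l \<sigma> refl True nz nzi in auto)
    next
      case False
      with a have aI: "a \<in> {1..n}" by auto
      then have "?m a = 1" by (simp add: mult_A_def)
      with l have l1: "l = 1" by (auto elim: oddE)
      \<comment> \<open>The lengths \<open>r\<close> cancel, leaving the cotangent of
        \<open>\<theta> i - \<theta> a\<close>; the factor \<open>\<i>\<close> compensates the one
        in \<open>cis_quotient\<close>.\<close>
      have "of_nat (?m i) * (bil (A i) (A a) / bil (A i) (perp (A a))) =
          \<i> * (of_nat (?m i) * (cis (2 * \<theta> i) + cis (2 * \<theta> a)) / (cis (2 * \<theta> i) - cis (2 * \<theta> a)))"
        if i: "i \<in> ?I - {a}" for i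
      proof -
        have *: "bil (A i) (A a) = of_real (r i * r a * cos (\<theta> i - \<theta> a))"
          "bil (A i) (perp (A a)) = of_real (r i * r a * sin (\<theta> i - \<theta> a))"
          unfolding A_def bil_complexify bil_perp_complexify using i
          by (simp_all add: r(2) [OF a] r(2) [of i] inner_vec_def sum_2 cos_diff sin_diff algebra_simps)
        have "bil (A i) (A a) / bil (A i) (perp (A a)) = of_real (cos (\<theta> i - \<theta> a) / sin (\<theta> i - \<theta> a))"
          unfolding * using r(1) [OF a] r(1) [of i] i by simp
        moreover have "\<i> * (w * (- \<i> * c)) = w * c" for w c
        proof -
          have "\<i> * (w * (- \<i> * c)) = - (\<i> * \<i>) * (w * c)" by algebra
          then show ?thesis by simp
        qed
        ultimately show ?thesis
          by (simp only: times_divide_eq_right [symmetric] cis_quotient)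
      qed
      then have "(\<Sum>i\<in>?I - {a}. of_nat (?m i) * (bil (A i) (A a) / bil (A i) (perp (A a)))) =
          \<i> * (\<Sum>i\<in>?I - {a}. of_nat (?m i) * (cis (2 * \<theta> i) + cis (2 * \<theta> a)) /
            (cis (2 * \<theta> i) - cis (2 * \<theta> a)))"
        unfolding sum_distrib_left by (intro sum.cong) auto
      also have "\<dots> = 0" using stieltjes aI by simp
      finally show ?thesis by (simp add: l1)
    qed
  qed (use nz nzi in auto)
qed

end
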